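(* Let $n\ge1$ be a fixed degree. For $\omega\in(0,(n+1)\pi)$ the unique minimizer $$r_\omega = \operatorname*{arg\,min}_{u \in \mathcal{U}_n} \| u - \exp(\omega \cdot)\|$$ depends continuously on $\omega$. In particular, $\|r_{\omega}-r_{\omega_a}\|\to 0$ for $\omega\to\omega_a\in(0,(n+1)\pi)$.
   Context: For a complex polynomial $p$ let $p^\dag(z):=\overline{p}(-z)=\overline{p(-\overline z)}$, where $\overline p$ has complex-conjugated coefficients. Let $\mathcal{U}_n:=\{p^\dag/p : p \text{ a complex polynomial of degree}\le n,\ p\not\equiv 0\}$, with rational functions identified with their irreducible form; then $r\in\mathcal{U}_n$ has no poles on $\mathrm{i}\mathbb{R}$ and $|r(\mathrm{i}x)|=1$ for $x\in\mathbb{R}$. For a complex function $f$ let $\|f\|:=\max_{x\in[-1,1]}|f(\mathrm{i}x)|$; in particular $\|u-\exp(\omega\cdot)\|=\max_{x\in[-1,1]}|u(\mathrm{i}x)-\mathrm{e}^{\mathrm{i}\omega x}|$. For $\omega\in(0,(n+1)\pi)$ the minimizer exists and is unique. *)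

theory Defs
  imports
    "HOL-Analysis.Analysis"
    "HOL-Computational_Algebra.Polynomial_Factorial"
    "HOL-Computational_Algebra.Field_as_Ring"
begin

text \<open>
  Rational functions are elements of \<^typ>\<open>complex poly fract\<close>, so that fractions with a common
  factor are identified. \<^const>\<open>quot_of_fract\<close> returns the coprime representative with monic
  denominator, and evaluation uses this irreducible form; removable singularities of a given
  representation therefore do not matter.
\<close>

definition rat_eval :: "complex poly fract \<Rightarrow> complex \<Rightarrow> complex" where
  "rat_eval r z = poly (fst (quot_of_fract r)) z / poly (snd (quot_of_fract r)) z"

definition dagger :: "complex poly \<Rightarrow> complex poly" where
  "dagger p = pcompose (map_poly cnj p) [:0, -1:]"

definition unitary_rat :: "nat \<Rightarrow> complex poly fract set" where
  "unitary_rat n = {Fract (dagger p) p | p. degree p \<le> n \<and> p \<noteq> 0}"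

text \<open>
  The maximum of the modulus over the segment from \<open>-\<i>\<close> to \<open>\<i>\<close>, written as a supremum; it is
  attained for the continuous functions to which it is applied.
\<close>

definition imag_norm :: "(complex \<Rightarrow> complex) \<Rightarrow> real" where
  "imag_norm f = (SUP x\<in>{-1..1::real}. cmod (f (\<i> * of_real x)))"

definition approx_error :: "real \<Rightarrow> complex poly fract \<Rightarrow> real" where
  "approx_error \<omega> u = imag_norm (\<lambda>z. rat_eval u z - exp (of_real \<omega> * z))"

definition best_approx :: "nat \<Rightarrow> real \<Rightarrow> complex poly fract" where
  "best_approx n \<omega> = (ARG_MIN (approx_error \<omega>) u. u \<in> unitary_rat n)"

text \<open>
  The restriction of \<open>u\<close> to the segment, as an element of a space carrying the supremum norm:
  the function \<open>x \<mapsto> u(\<i> x)\<close> on \<open>[-1,1]\<close> is extended constantly to the real line by clamping,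
  which leaves the norm unchanged (lemma \<open>dist_segment_fun\<close>).
\<close>

definition segment_fun :: "complex poly fract \<Rightarrow> real \<Rightarrow>\<^sub>C complex" where
  "segment_fun u = Bcontfun (\<lambda>x. rat_eval u (\<i> * of_real (clamp (-1) 1 x)))"

lemma poly_dagger: "poly (dagger p) z = cnj (poly p (- cnj z))"
  using poly_cnj[of p "- cnj z"] by (simp add: dagger_def poly_pcompose)

lemma unitary_rat_no_pole:
  assumes "u \<in> unitary_rat n"
  shows "poly (snd (quot_of_fract u)) (\<i> * of_real x) \<noteq> 0"
    and "cmod (rat_eval u (\<i> * of_real x)) = 1"
proof -
  define z where "z = \<i> * complex_of_real x"
  have z: "- cnj z = z" by (simp add: z_def)
  from assms obtain p where p: "p \<noteq> 0" "u = Fract (dagger p) p"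
    by (auto simp: unitary_rat_def)
  define a where "a = fst (quot_of_fract u)"
  define b where "b = snd (quot_of_fract u)"
  have q: "quot_of_fract u = normalize_quot (dagger p, p)"
    using quot_of_fract_quot_to_fract[of "(dagger p, p)"] p by (simp add: quot_to_fract_def)
  obtain d where d: "dagger p = a * d" "p = b * d" "d \<noteq> 0"
    unfolding a_def b_def q by (rule normalize_quotE[OF p(1), of "dagger p"])
  have b0: "b \<noteq> 0" using p(1) d(2) by (metis mult_zero_left)
  have cop: "coprime a b"
    unfolding a_def b_def q by (rule coprime_normalize_quot)
  have norm_eq: "cmod (poly a w) = cmod (poly b w)" if "- cnj w = w" "poly d w \<noteq> 0" for w
  proof -
    have "cmod (poly (dagger p) w) = cmod (poly p w)"
      using that(1) by (simp add: poly_dagger)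
    then have "cmod (poly a w) * cmod (poly d w) = cmod (poly b w) * cmod (poly d w)"
      by (metis d(1,2) norm_mult poly_mult)
    with that(2) show ?thesis by simp
  qed
  have "cmod (poly a z) = cmod (poly b z)"
  proof -
    let ?f = "\<lambda>t::real. cmod (poly a (\<i> * of_real t)) - cmod (poly b (\<i> * of_real t))"
    have "finite {w. poly d w = 0}"
      using d(3) by (rule poly_roots_finite)
    then have "finite ((\<lambda>t. \<i> * complex_of_real t) -` {w. poly d w = 0})"
      by (rule finite_vimageI) (auto simp: inj_on_def)
    then have "\<forall>\<^sub>F t in at x. t \<notin> (\<lambda>t. \<i> * complex_of_real t) -` {w. poly d w = 0}"
      by (rule islimpt_finite[unfolded islimpt_iff_eventually not_not])
    then have "\<forall>\<^sub>F t in at x. ?f t = 0"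
      by eventually_elim (simp add: norm_eq)
    then have "(?f \<longlongrightarrow> 0) (at x)"
      by (simp add: tendsto_eventually)
    moreover have "(?f \<longlongrightarrow> ?f x) (at x)"
      by (intro tendsto_intros)
    ultimately have "?f x = 0"
      using LIM_unique by blast
    then show ?thesis by (simp add: z_def)
  qed
  moreover have "poly b z \<noteq> 0"
  proof
    assume b: "poly b z = 0"
    with calculation have "poly a z = 0" by simp
    with b cop show False
      by (metis coprime_poly_0)
  qed
  ultimately have "poly b z \<noteq> 0" "cmod (poly a z / poly b z) = 1"
    by (simp_all add: norm_divide)
  then show "poly (snd (quot_of_fract u)) (\<i> * of_real x) \<noteq> 0"
    and "cmod (rat_eval u (\<i> * of_real x)) = 1"
    by (simp_all only: rat_eval_def a_def b_def z_def not_False_eq_True)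
qed

lemma apply_segment_fun:
  assumes "u \<in> unitary_rat n"
  shows "segment_fun u x = rat_eval u (\<i> * of_real (clamp (-1) 1 x))"
proof -
  have "continuous_on UNIV (\<lambda>x. rat_eval u (\<i> * of_real (clamp (-1) 1 x)))"
    unfolding rat_eval_def
    by (intro clamp_continuous_on[where f = "\<lambda>x. poly (fst (quot_of_fract u)) (\<i> * of_real x) /
          poly (snd (quot_of_fract u)) (\<i> * of_real x)"] continuous_intros)
       (use unitary_rat_no_pole[OF assms] in auto)
  then have "(\<lambda>x. rat_eval u (\<i> * of_real (clamp (-1) 1 x))) \<in> bcontfun"
    by (rule bcontfun_normI[where b = 1]) (simp add: unitary_rat_no_pole(2)[OF assms])
  then show ?thesis
    by (simp add: segment_fun_def Bcontfun_inverse)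
qed

lemma dist_segment_fun:
  assumes "u \<in> unitary_rat n" "v \<in> unitary_rat m"
  shows "dist (segment_fun u) (segment_fun v) = imag_norm (\<lambda>z. rat_eval u z - rat_eval v z)"
proof -
  let ?g = "\<lambda>x::real. cmod (rat_eval u (\<i> * of_real x) - rat_eval v (\<i> * of_real x))"
  have cl: "clamp (-1) 1 y \<in> {-1..1}" for y :: real
    using clamp_in_interval[of "-1" "1::real" y] by (simp add: cbox_interval)
  have "clamp (-1) 1 y = y" if "y \<in> {-1..1}" for y :: real
    by (rule clamp_cancel_cbox) (use that in \<open>simp add: cbox_interval\<close>)
  then have "{-1..1} \<subseteq> range (clamp (-1) (1::real))"
    by (metis rangeI subsetI)
  then have ran: "range (clamp (-1) (1::real)) = {-1..1}"
    using cl by blast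
  have "range (\<lambda>x. ?g (clamp (-1) 1 x)) = ?g ` range (clamp (-1) 1)"
    by (rule image_image[symmetric])
  then have sup: "(SUP x. ?g (clamp (-1) 1 x)) = (SUP x\<in>{-1..1}. ?g x)"
    unfolding ran by (rule arg_cong)
  have "dist (segment_fun u) (segment_fun v) = (SUP x. dist (segment_fun u x) (segment_fun v x))"
    by (rule dist_bcontfun.rep_eq)
  also have "\<dots> = (SUP x. ?g (clamp (-1) 1 x))"
    unfolding apply_segment_fun[OF assms(1)] apply_segment_fun[OF assms(2)] dist_norm ..
  finally show ?thesis
    unfolding sup imag_norm_def .
qed

end

theory Submission
  imports Defs
begin

text \<open>
  On the imaginary axis a polynomial takes the values \<open>p(i x) = A(x) + i B(x)\<close> with real polynomials
  \<open>A\<close>, \<open>B\<close>, and there \<open>p\<^sup>\<dagger>/p = (A - i B)/(A + i B)\<close>. Let \<open>X + i Y = exp(i \<omega> x/2) (A + i B)\<close>. The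
  distance of \<open>p\<^sup>\<dagger>/p\<close> to \<open>exp(i \<omega> x)\<close> is then \<open>2 \<bar>Y\<bar>/sqrt(X\<^sup>2 + Y\<^sup>2)\<close>, so that an error of at most
  \<open>e\<close> is the quadratic inequality \<open>4 Y\<^sup>2 \<le> e\<^sup>2 (X\<^sup>2 + Y\<^sup>2)\<close>. If \<open>e < 2\<close> and \<open>X > 0\<close>, this is a pair
  of linear inequalities in \<open>(A, B)\<close>: the phase problem becomes a linear one.

  The core is a count of the points at which a minimizer with error below 2 attains its error. Let
  \<open>A\<close>, \<open>B\<close> be coprime and \<open>m\<close> the larger of their degrees. When \<open>(A, B)\<close> moves in the direction
  \<open>(a, b)\<close>, the first-order change at an extremal point is \<open>A b - B a\<close> times a nonzero number. By
  Bezout every real polynomial of degree at most \<open>n + m\<close> has the form \<open>A b - B a\<close> with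
  \<open>a\<close>, \<open>b\<close> of degree at most \<open>n\<close>; so if there are
  at most \<open>n + m + 1\<close> extremal points, interpolation yields a direction in which the error
  decreases everywhere (\<open>ex_better_approximation\<close>). On the other hand the extremal points inside
  the segment are roots of \<open>\<omega>/2 (A\<^sup>2 + B\<^sup>2) + A B' - B A'\<close>, up to a positive factor the derivative
  of the argument of \<open>X + i Y\<close>. This polynomial has degree \<open>2 m\<close> because \<open>\<omega> \<noteq> 0\<close>, so together with
  the two endpoints there are at most \<open>2 m + 2\<close> extremal points. Comparing the two bounds gives
  \<open>m = n\<close> and at least \<open>2 n + 2\<close> extremal points (\<open>extremal_points_of_minimizer\<close>).

  The error is below 2 as soon as \<open>X > 0\<close> for some admissible pair. For \<open>\<omega> < (n + 1) \<pi>\<close> such a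
  pair exists since a shifted sine of frequency \<open>\<omega>/2\<close> has at most \<open>n\<close> zeros in the segment
  (\<open>ex_approx_error_less_2\<close>).

  Uniqueness (\<open>minimizer_unique\<close>): by linearity the sum of the pairs of two minimizers represents a
  minimizer as well. At its extremal points, at least \<open>2 n + 2\<close> in number, the vectors \<open>(X, Y)\<close> of
  both summands lie on the same boundary ray of the cone given by the linear inequalities, so the cross
  polynomial \<open>A b - B a\<close> of degree at most \<open>2 n\<close> vanishes there and is zero.

  Existence and continuity follow by compactness of normalized pairs. A limit of minimizers is a
  minimizer for the limit frequency, hence the unique one. By \<open>m = n\<close> the limit pair has no
  common factor, so nothing cancels and the convergence is uniform on the segment
  (\<open>continuous_on_best_approx\<close>).
\<close>

section \<open>Unitary functions as pairs of real polynomials\<close>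

text \<open>
  The complex polynomial with \<open>p(i x) = A(x) + i B(x)\<close> for real \<open>x\<close>; substituting \<open>-i z\<close>
  undoes the rotation to the imaginary axis.
\<close>

definition axis_poly :: "real poly \<Rightarrow> real poly \<Rightarrow> complex poly" where
  "axis_poly A B =
     pcompose (map_poly of_real A + smult \<i> (map_poly of_real B)) [:0, - \<i>:]"

definition unitary_of :: "real poly \<Rightarrow> real poly \<Rightarrow> complex poly fract" where
  "unitary_of A B = Fract (axis_poly A (- B)) (axis_poly A B)"

lemma poly_eq_on_axis:
  assumes "\<And>x::real. poly p (\<i> * of_real x) = poly q (\<i> * of_real x)"
  shows "p = q"
proof (rule ccontr)
  assume "p \<noteq> q"
  then have "finite {z. poly (p - q) z = 0}" by (intro poly_roots_finite) simp
  moreover have "range (\<lambda>x::real. \<i> * of_real x) \<subseteq> {z. poly (p - q) z = 0}"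
    using assms by auto
  ultimately have "finite (range (\<lambda>x::real. \<i> * complex_of_real x))"
    by (rule rev_finite_subset)
  then show False
    using finite_imageD[of "\<lambda>x::real. \<i> * complex_of_real x" UNIV]
    by (auto simp: inj_on_def infinite_UNIV_char_0)
qed

lemma poly_map_poly_of_real:
  "poly (map_poly of_real p) (of_real x) = complex_of_real (poly p x)"
  by (induction p) (simp_all add: map_poly_pCons)

lemma poly_axis_poly:
  "poly (axis_poly A B) (\<i> * of_real x) = of_real (poly A x) + \<i> * of_real (poly B x)"
proof -
  have "- (\<i> * (\<i> * of_real x)) = complex_of_real x"
    by (simp flip: mult.assoc)
  then show ?thesis
    by (simp add: axis_poly_def poly_pcompose poly_map_poly_of_real mult_ac)
qed

text \<open>
  On the imaginary axis \<open>- cnj z = z\<close>, so the dagger acts there as complex conjugation.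
\<close>

lemma dagger_axis_poly: "dagger (axis_poly A B) = axis_poly A (- B)"
  by (rule poly_eq_on_axis) (simp add: poly_dagger poly_axis_poly)

lemma axis_poly_eq_0_iff: "axis_poly A B = 0 \<longleftrightarrow> A = 0 \<and> B = 0"
proof
  assume "axis_poly A B = 0"
  then have "poly A x = 0 \<and> poly B x = 0" for x
    using poly_axis_poly[of A B x] by (auto simp: complex_eq_iff)
  then show "A = 0 \<and> B = 0" using poly_all_0_iff_0 by metis
qed (simp add: axis_poly_def)

lemma degree_axis_poly_le:
  assumes "degree A \<le> n" "degree B \<le> n"
  shows "degree (axis_poly A B) \<le> n"
proof -
  have "degree (axis_poly A B) \<le>
      degree (map_poly of_real A + smult \<i> (map_poly of_real B)) * degree [:0, - \<i>:]"
    unfolding axis_poly_def by (rule degree_pcompose_le)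
  also have "\<dots> \<le> n"
    using assms by (auto intro!: degree_add_le degree_smult_le[THEN order_trans]
        map_poly_degree_leq[THEN order_trans])
  finally show ?thesis .
qed

lemma ex_axis_poly:
  obtains A B where "p = axis_poly A B" "degree A \<le> degree p" "degree B \<le> degree p"
proof
  define P where "P = pcompose p [:0, \<i>:]"
  have deg: "degree P \<le> degree p"
    using degree_pcompose_le[of p "[:0, \<i>:]"] by (simp add: P_def)
  have eq: "map_poly of_real (map_poly Re P) + smult \<i> (map_poly of_real (map_poly Im P)) = P"
    by (rule poly_eqI) (simp add: coeff_map_poly complex_eq_iff)
  then show "p = axis_poly (map_poly Re P) (map_poly Im P)"
    unfolding axis_poly_def eq P_def
    by (intro poly_eq_on_axis) (simp add: poly_pcompose algebra_simps)
  show "degree (map_poly Re P) \<le> degree p" "degree (map_poly Im P) \<le> degree p"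
    by (rule order_trans[OF map_poly_degree_leq deg])+
qed

lemma unitary_of_in_unitary_rat:
  assumes "degree A \<le> n" "degree B \<le> n" "A \<noteq> 0 \<or> B \<noteq> 0"
  shows "unitary_of A B \<in> unitary_rat n"
proof -
  have "unitary_of A B = Fract (dagger (axis_poly A B)) (axis_poly A B)"
    by (simp only: unitary_of_def dagger_axis_poly)
  moreover have "degree (axis_poly A B) \<le> n" "axis_poly A B \<noteq> 0"
    using assms by (simp_all only: degree_axis_poly_le axis_poly_eq_0_iff) auto
  ultimately show ?thesis
    unfolding unitary_rat_def by blast
qed

text \<open>
  The two fractions agree iff \<open>cnj P * P'\<close> is real on the axis, where \<open>P = A + i B\<close> and
  \<open>P' = A' + i B'\<close>; its imaginary part is the cross polynomial.
\<close>

lemma unitary_of_eq_iff: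
  assumes "A \<noteq> 0 \<or> B \<noteq> 0" "A' \<noteq> 0 \<or> B' \<noteq> 0"
  shows "unitary_of A B = unitary_of A' B' \<longleftrightarrow> A * B' = B * A'"
proof -
  have "unitary_of A B = unitary_of A' B' \<longleftrightarrow>
      axis_poly A (- B) * axis_poly A' B' = axis_poly A' (- B') * axis_poly A B"
    using assms by (simp add: unitary_of_def eq_fract axis_poly_eq_0_iff)
  also have "\<dots> \<longleftrightarrow> (\<forall>x. poly (A * B') x = poly (B * A') x)"
  proof
    assume eq: "axis_poly A (- B) * axis_poly A' B' = axis_poly A' (- B') * axis_poly A B"
    show "\<forall>x. poly (A * B') x = poly (B * A') x"
    proof
      fix x
      show "poly (A * B') x = poly (B * A') x"
        using arg_cong[OF eq, of "\<lambda>p. poly p (\<i> * of_real x)"]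
        by (simp add: poly_axis_poly complex_eq_iff algebra_simps)
    qed
  next
    assume "\<forall>x. poly (A * B') x = poly (B * A') x"
    then show "axis_poly A (- B) * axis_poly A' B' = axis_poly A' (- B') * axis_poly A B"
      by (intro poly_eq_on_axis) (simp add: poly_axis_poly complex_eq_iff algebra_simps)
  qed
  also have "\<dots> \<longleftrightarrow> A * B' = B * A'"
    by (metis poly_eq_poly_eq_iff ext)
  finally show ?thesis .
qed

text \<open>
  A common real factor of \<open>A\<close> and \<open>B\<close> cancels between \<open>A - i B\<close> and \<open>A + i B\<close>. Once it is removed,
  \<open>A\<close> and \<open>B\<close> have no common root, and the denominator has no zero on the imaginary axis.
\<close>

lemma coprime_cofactors:
  assumes nz: "A \<noteq> 0 \<or> B \<noteq> 0" and deg: "degree A \<le> n" "degree B \<le> n"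
  obtains G A' B' where "A = G * A'" "B = G * B'" "G \<noteq> 0" "coprime A' B'"
    "unitary_of A B = unitary_of A' B'" "degree G + max (degree A') (degree B') \<le> n"
proof -
  define G where "G = gcd A B"
  then have G: "G \<noteq> 0" using nz by simp
  obtain A' B' where A': "A = G * A'" and B': "B = G * B'"
    unfolding G_def by (meson dvdE gcd_dvd1 gcd_dvd2)
  have "coprime A' B'"
    using nz gcd_coprime[of A B A' B'] A' B' by (metis G_def gcd_eq_0_iff mult.commute)
  moreover have "unitary_of A B = unitary_of A' B'"
    using nz A' B' by (subst unitary_of_eq_iff) auto
  moreover have "degree G + degree A' \<le> n" if "A' \<noteq> 0"
    using that A' G deg by (simp add: degree_mult_eq)
  moreover have "degree G + degree B' \<le> n" if "B' \<noteq> 0"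
    using that B' G deg by (simp add: degree_mult_eq)
  moreover have "A' \<noteq> 0 \<or> B' \<noteq> 0" using nz A' B' by auto
  ultimately show thesis
    using that[OF A' B' G] by (cases "A' = 0"; cases "B' = 0") (auto simp: max_def)
qed

lemma unitary_rat_coprime_pair:
  assumes "u \<in> unitary_rat n"
  obtains A B where "u = unitary_of A B" "coprime A B" "degree A \<le> n" "degree B \<le> n"
proof -
  obtain p where p: "u = Fract (dagger p) p" "degree p \<le> n" "p \<noteq> 0"
    using assms by (auto simp: unitary_rat_def)
  obtain A B where AB: "p = axis_poly A B" "degree A \<le> degree p" "degree B \<le> degree p"
    by (rule ex_axis_poly)
  then have nz: "A \<noteq> 0 \<or> B \<noteq> 0" and deg: "degree A \<le> n" "degree B \<le> n"
    using p(2,3) axis_poly_eq_0_iff by auto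
  have "u = unitary_of A B"
    by (simp only: p(1) AB(1) dagger_axis_poly unitary_of_def)
  moreover obtain G A' B' where "A = G * A'" "B = G * B'" "G \<noteq> 0" "coprime A' B'"
    "unitary_of A B = unitary_of A' B'" "degree G + max (degree A') (degree B') \<le> n"
    by (rule coprime_cofactors[OF nz deg])
  ultimately show thesis using that[of A' B'] by simp
qed

text \<open>
  Away from the zeros of a given denominator, any representation computes the value of the
  irreducible form.
\<close>

lemma rat_eval_Fract:
  assumes "poly p z \<noteq> 0"
  shows "rat_eval (Fract q p) z = poly q z / poly p z"
proof -
  have p: "p \<noteq> 0" using assms by auto
  obtain d where d: "q = fst (normalize_quot (q, p)) * d" "p = snd (normalize_quot (q, p)) * d"
    by (rule normalize_quotE[OF p, of q])
  have "quot_of_fract (Fract q p) = normalize_quot (q, p)"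
    using quot_of_fract_quot_to_fract[of "(q, p)"] p by (simp add: quot_to_fract_def)
  then show ?thesis
    using assms arg_cong[OF d(1), of "\<lambda>p. poly p z"] arg_cong[OF d(2), of "\<lambda>p. poly p z"]
    by (simp add: rat_eval_def)
qed

section \<open>The pointwise error in rotated coordinates\<close>

definition deviation :: "real \<Rightarrow> complex poly fract \<Rightarrow> real \<Rightarrow> real" where
  "deviation \<omega> u x = cmod (rat_eval u (\<i> * of_real x) - exp (of_real \<omega> * (\<i> * of_real x)))"

lemma deviation_le_2:
  assumes "u \<in> unitary_rat n"
  shows "deviation \<omega> u x \<le> 2"
proof -
  have "cmod (exp (of_real \<omega> * (\<i> * of_real x))) = 1"
    by (simp add: norm_exp_eq_Re)
  then show ?thesis
    unfolding deviation_def
    using norm_triangle_ineq4[of "rat_eval u (\<i> * of_real x)" "exp (of_real \<omega> * (\<i> * of_real x))"]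
      unitary_rat_no_pole(2)[OF assms, of x] by linarith
qed

lemma approx_error_eq_SUP: "approx_error \<omega> u = (SUP x\<in>{-1..1}. deviation \<omega> u x)"
  by (simp add: approx_error_def imag_norm_def deviation_def)

lemma approx_error_le_iff:
  assumes "u \<in> unitary_rat n"
  shows "approx_error \<omega> u \<le> e \<longleftrightarrow> (\<forall>x\<in>{-1..1}. deviation \<omega> u x \<le> e)"
  unfolding approx_error_eq_SUP
  by (rule cSUP_le_iff) (auto intro!: bdd_aboveI2 deviation_le_2[OF assms])

lemma deviation_le_approx_error:
  "u \<in> unitary_rat n \<Longrightarrow> x \<in> {-1..1} \<Longrightarrow> deviation \<omega> u x \<le> approx_error \<omega> u"
  using approx_error_le_iff[of u n \<omega> "approx_error \<omega> u"] by blast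

lemma approx_error_nonneg:
  assumes "u \<in> unitary_rat n"
  shows "0 \<le> approx_error \<omega> u"
  using deviation_le_approx_error[OF assms, of 0 \<omega>] by (simp add: deviation_def order_trans[OF norm_ge_zero])

lemma continuous_on_deviation:
  assumes "u \<in> unitary_rat n"
  shows "continuous_on S (deviation \<omega> u)"
  unfolding deviation_def rat_eval_def
  by (intro continuous_intros) (use unitary_rat_no_pole[OF assms] in auto)

lemma approx_error_attained:
  assumes "u \<in> unitary_rat n"
  obtains x where "x \<in> {-1..1}" "deviation \<omega> u x = approx_error \<omega> u"
proof -
  obtain x where x: "x \<in> {-1..1}" "\<And>y. y \<in> {-1..1} \<Longrightarrow> deviation \<omega> u y \<le> deviation \<omega> u x"
    using continuous_attains_sup[OF compact_Icc _ continuous_on_deviation[OF assms], of "-1" 1 \<omega>]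
    by auto
  then have "approx_error \<omega> u \<le> deviation \<omega> u x"
    by (simp add: approx_error_le_iff[OF assms])
  then show thesis
    using that[OF x(1)] deviation_le_approx_error[OF assms x(1), of \<omega>] by linarith
qed

text \<open>
  The points \<open>exp(i \<omega> x)\<close> and \<open>exp(i \<omega>' x)\<close> are at distance at most \<open>\<bar>\<omega> - \<omega>'\<bar>\<close> for \<open>\<bar>x\<bar> \<le> 1\<close>.
\<close>

lemma approx_error_Lipschitz:
  assumes "u \<in> unitary_rat n"
  shows "approx_error \<omega> u \<le> approx_error \<omega>' u + \<bar>\<omega> - \<omega>'\<bar>"
proof -
  have "deviation \<omega> u x \<le> approx_error \<omega>' u + \<bar>\<omega> - \<omega>'\<bar>" if x: "x \<in> {-1..1}" for x
  proof -
    have "deviation \<omega> u x \<le> deviation \<omega>' u x + cmod (cis (\<omega>' * x) - cis (\<omega> * x))"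
      unfolding deviation_def cis_conv_exp
      by (rule order_trans[OF eq_refl norm_triangle_ineq]) (simp add: algebra_simps)
    also have "cmod (cis (\<omega>' * x) - cis (\<omega> * x)) \<le> \<bar>\<omega> - \<omega>'\<bar>"
    proof -
      have "cmod (cis (\<omega>' * x) - cis (\<omega> * x)) = cmod (cis (\<omega> * x) * (cis ((\<omega>' - \<omega>) * x) - 1))"
        by (simp add: algebra_simps cis_mult)
      also have "\<dots> = cmod (cis ((\<omega>' - \<omega>) * x) - 1)"
        by (simp add: norm_mult)
      also have "\<dots> \<le> \<bar>(\<omega>' - \<omega>) * x\<bar>"
        using dist_exp_i_1[of "(\<omega>' - \<omega>) * x"] abs_sin_x_le_abs_x[of "(\<omega>' - \<omega>) * x / 2"]
        by (simp add: cis_conv_exp)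
      also have "\<dots> \<le> \<bar>\<omega> - \<omega>'\<bar> * 1"
        unfolding abs_mult by (rule mult_mono) (use x in auto)
      finally show ?thesis by simp
    qed
    finally show ?thesis
      using deviation_le_approx_error[OF assms x, of \<omega>'] by linarith
  qed
  then show ?thesis
    by (simp add: approx_error_le_iff[OF assms])
qed

text \<open>
  Real and imaginary part of \<open>exp(i \<omega> x/2) (A(x) + i B(x))\<close>. Half of the frequency appears
  because \<open>(A - i B)/(A + i B)\<close> doubles the phase of \<open>A + i B\<close>.
\<close>

definition rot_Re :: "real \<Rightarrow> real poly \<Rightarrow> real poly \<Rightarrow> real \<Rightarrow> real" where
  "rot_Re \<omega> A B x = poly A x * cos (\<omega> / 2 * x) - poly B x * sin (\<omega> / 2 * x)"

definition rot_Im :: "real \<Rightarrow> real poly \<Rightarrow> real poly \<Rightarrow> real \<Rightarrow> real" where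
  "rot_Im \<omega> A B x = poly A x * sin (\<omega> / 2 * x) + poly B x * cos (\<omega> / 2 * x)"

text \<open>
  Up to the positive factor \<open>A\<^sup>2 + B\<^sup>2\<close> this is the squared deviation minus \<open>e\<^sup>2\<close>. As a quadratic form
  in \<open>(A, B)\<close> it can be expanded under perturbations.
\<close>

definition excess :: "real \<Rightarrow> real \<Rightarrow> real poly \<Rightarrow> real poly \<Rightarrow> real \<Rightarrow> real" where
  "excess \<omega> e A B x = 4 * (rot_Im \<omega> A B x)\<^sup>2 - e\<^sup>2 * ((rot_Re \<omega> A B x)\<^sup>2 + (rot_Im \<omega> A B x)\<^sup>2)"

lemma rot_sum_squares:
  "(rot_Re \<omega> A B x)\<^sup>2 + (rot_Im \<omega> A B x)\<^sup>2 = (poly A x)\<^sup>2 + (poly B x)\<^sup>2"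
proof -
  have "(rot_Re \<omega> A B x)\<^sup>2 + (rot_Im \<omega> A B x)\<^sup>2 =
      ((poly A x)\<^sup>2 + (poly B x)\<^sup>2) * ((sin (\<omega> / 2 * x))\<^sup>2 + (cos (\<omega> / 2 * x))\<^sup>2)"
    unfolding rot_Re_def rot_Im_def by algebra
  then show ?thesis by simp
qed

text \<open>
  A common rotation leaves the imaginary part of \<open>cnj P * P'\<close> unchanged: this is why the frequency
  disappears from the interpolation problem below.
\<close>

lemma rot_cross:
  "rot_Re \<omega> A B x * rot_Im \<omega> A' B' x - rot_Im \<omega> A B x * rot_Re \<omega> A' B' x =
   poly A x * poly B' x - poly B x * poly A' x"
proof -
  have "rot_Re \<omega> A B x * rot_Im \<omega> A' B' x - rot_Im \<omega> A B x * rot_Re \<omega> A' B' x =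
      (poly A x * poly B' x - poly B x * poly A' x) *
        ((sin (\<omega> / 2 * x))\<^sup>2 + (cos (\<omega> / 2 * x))\<^sup>2)"
    unfolding rot_Re_def rot_Im_def by algebra
  then show ?thesis by simp
qed

lemma rot_add:
  "rot_Re \<omega> (A + A') (B + B') x = rot_Re \<omega> A B x + rot_Re \<omega> A' B' x"
  "rot_Im \<omega> (A + A') (B + B') x = rot_Im \<omega> A B x + rot_Im \<omega> A' B' x"
  by (simp_all add: rot_Re_def rot_Im_def algebra_simps)

lemma rot_mult:
  "rot_Re \<omega> (D * A) (D * B) x = poly D x * rot_Re \<omega> A B x"
  "rot_Im \<omega> (D * A) (D * B) x = poly D x * rot_Im \<omega> A B x"
  by (simp_all add: rot_Re_def rot_Im_def algebra_simps)

lemma excess_mult: "excess \<omega> e (D * A) (D * B) x = (poly D x)\<^sup>2 * excess \<omega> e A B x"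
  unfolding excess_def rot_mult by algebra

lemma rat_eval_unitary_of:
  assumes "poly A x \<noteq> 0 \<or> poly B x \<noteq> 0"
  shows "rat_eval (unitary_of A B) (\<i> * of_real x) =
    Complex (poly A x) (- poly B x) / Complex (poly A x) (poly B x)"
proof -
  have "poly (axis_poly A B) (\<i> * of_real x) = Complex (poly A x) (poly B x)"
    "poly (axis_poly A (- B)) (\<i> * of_real x) = Complex (poly A x) (- poly B x)"
    by (simp_all add: poly_axis_poly Complex_eq)
  then show ?thesis
    using assms unfolding unitary_of_def by (subst rat_eval_Fract) (auto simp: Complex_eq_0)
qed

text \<open>
  With \<open>w = exp(i \<omega> x/2) P\<close>, the deviation equals \<open>cmod (cnj w / w - 1) = 2 \<bar>Im w\<bar> / cmod w\<close>.
\<close>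

lemma deviation_unitary_of:
  assumes "poly A x \<noteq> 0 \<or> poly B x \<noteq> 0"
  shows "(deviation \<omega> (unitary_of A B) x)\<^sup>2 * ((poly A x)\<^sup>2 + (poly B x)\<^sup>2) =
    4 * (rot_Im \<omega> A B x)\<^sup>2"
proof -
  define P where "P = Complex (poly A x) (poly B x)"
  define E where "E = cis (\<omega> / 2 * x)"
  have P: "P \<noteq> 0" using assms by (simp add: P_def complex_eq_iff)
  have EE: "exp (of_real \<omega> * (\<i> * of_real x)) = E * E"
    unfolding E_def cis_mult by (simp add: cis_conv_exp algebra_simps)
  have "E * cnj E = 1"
    by (simp add: E_def cis_mult cis_cnj)
  have "rat_eval (unitary_of A B) (\<i> * of_real x) - E * E = (cnj P - E * E * P) / P"
    using P by (subst rat_eval_unitary_of[OF assms]) (simp add: P_def complex_cnj diff_divide_distrib)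
  also have "cnj P - E * E * P = E * (cnj (E * P) - E * P)"
    unfolding complex_cnj_mult using \<open>E * cnj E = 1\<close> by algebra
  also have "cnj (E * P) - E * P = - (2 * \<i> * of_real (rot_Im \<omega> A B x))"
    by (simp add: complex_eq_iff E_def P_def rot_Im_def)
  finally have "deviation \<omega> (unitary_of A B) x = 2 * \<bar>rot_Im \<omega> A B x\<bar> / cmod P"
    unfolding deviation_def EE by (simp add: norm_mult norm_divide E_def)
  moreover have "(cmod P)\<^sup>2 = (poly A x)\<^sup>2 + (poly B x)\<^sup>2"
    by (simp add: P_def cmod_power2)
  ultimately show ?thesis
    using P by (simp add: power_divide power_mult_distrib flip: \<open>(cmod P)\<^sup>2 = _\<close>)
qed

lemma excess_eq_deviation:
  assumes "poly A x \<noteq> 0 \<or> poly B x \<noteq> 0"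
  shows "excess \<omega> e A B x =
    ((deviation \<omega> (unitary_of A B) x)\<^sup>2 - e\<^sup>2) * ((poly A x)\<^sup>2 + (poly B x)\<^sup>2)"
  unfolding excess_def rot_sum_squares left_diff_distrib deviation_unitary_of[OF assms] ..

lemma deviation_iff_excess:
  assumes "poly A x \<noteq> 0 \<or> poly B x \<noteq> 0" "0 \<le> e"
  shows deviation_le_iff: "deviation \<omega> (unitary_of A B) x \<le> e \<longleftrightarrow> excess \<omega> e A B x \<le> 0"
    and deviation_less_iff: "deviation \<omega> (unitary_of A B) x < e \<longleftrightarrow> excess \<omega> e A B x < 0"
    and deviation_eq_iff: "deviation \<omega> (unitary_of A B) x = e \<longleftrightarrow> excess \<omega> e A B x = 0"
proof -
  have pos: "(poly A x)\<^sup>2 + (poly B x)\<^sup>2 > 0"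
    using assms(1) by (simp add: sum_power2_gt_zero_iff)
  have nonneg: "0 \<le> deviation \<omega> (unitary_of A B) x"
    by (simp add: deviation_def)
  show "deviation \<omega> (unitary_of A B) x \<le> e \<longleftrightarrow> excess \<omega> e A B x \<le> 0"
    unfolding excess_eq_deviation[OF assms(1)] using pos nonneg assms(2)
    by (simp add: mult_le_0_iff)
  show "deviation \<omega> (unitary_of A B) x < e \<longleftrightarrow> excess \<omega> e A B x < 0"
    unfolding excess_eq_deviation[OF assms(1)] using pos nonneg assms(2)
    by (auto simp: mult_less_0_iff intro: power2_less_imp_less power_strict_mono)
  show "deviation \<omega> (unitary_of A B) x = e \<longleftrightarrow> excess \<omega> e A B x = 0"
    unfolding excess_eq_deviation[OF assms(1)] using pos nonneg assms
    by (auto simp: power2_eq_iff_nonneg)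
qed

lemma continuous_on_rot [continuous_intros]:
  "continuous_on S (rot_Re \<omega> A B)" "continuous_on S (rot_Im \<omega> A B)"
  unfolding rot_Re_def rot_Im_def by (intro continuous_intros)+

lemma continuous_on_excess [continuous_intros]: "continuous_on S (excess \<omega> e A B)"
  unfolding excess_def by (intro continuous_intros)

lemma coprime_no_common_root:
  fixes A B :: "real poly"
  assumes "coprime A B"
  shows "poly A x \<noteq> 0 \<or> poly B x \<noteq> 0"
  using assms by (metis coprime_poly_0)

section \<open>Improving an approximation with few extremal points\<close>

text \<open>
  Newton interpolation: a new node is met by adding a multiple of the product of the linear factors
  of the old ones.
\<close>

lemma ex_interpolating_poly:
  fixes v :: "'a::field \<Rightarrow> 'a"
  assumes "finite Z"
  shows "\<exists>S. degree S \<le> card Z - 1 \<and> (\<forall>x\<in>Z. poly S x = v x)"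
  using assms
proof (induction Z rule: finite_induct)
  case empty
  show ?case by (rule exI[of _ 0]) simp
next
  case (insert z Z)
  then obtain S where S: "degree S \<le> card Z - 1" "\<forall>x\<in>Z. poly S x = v x" by blast
  define N where "N = (\<Prod>y\<in>Z. [:- y, 1:])"
  define c where "c = (v z - poly S z) / poly N z"
  have "poly N z \<noteq> 0" "\<forall>x\<in>Z. poly N x = 0"
    using insert(1,2) by (auto simp: N_def poly_prod)
  moreover have "degree N \<le> card Z"
    unfolding N_def using degree_prod_sum_le[OF insert(1), of "\<lambda>y. [:- y, 1:]"] by simp
  ultimately have "degree (S + smult c N) \<le> card (insert z Z) - 1"
    "\<forall>x\<in>insert z Z. poly (S + smult c N) x = v x"
    using insert S by (auto intro!: degree_add_le degree_smult_le[THEN order_trans] simp: c_def)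
  then show ?case by blast
qed

text \<open>
  Start from a Bezout identity multiplied by \<open>S\<close> and reduce the cofactor of \<open>B\<close> modulo \<open>A\<close>. The
  remainder has degree at most that of \<open>A\<close>, and comparing degrees in the identity then bounds the
  cofactor of \<open>A\<close>.
\<close>

lemma ex_cross_representation_dominant:
  fixes A B S :: "'a::{field_gcd} poly"
  assumes "coprime A B" "A \<noteq> 0" "degree B \<le> degree A" "degree A \<le> n"
    and "degree S \<le> n + degree A"
  shows "\<exists>a b. degree a \<le> n \<and> degree b \<le> n \<and> A * b - B * a = S"
proof -
  obtain s t where st: "s * A + t * B = 1"
    using bezout_coefficients_fst_snd[of A B] assms(1) by (metis coprime_imp_gcd_eq_1)
  define r where "r = (t * S) mod A"
  define b where "b = s * S + (t * S) div A * B"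
  have "t * S = (t * S) div A * A + r"
    by (simp add: r_def)
  then have eq: "A * b - B * (- r) = S"
    using st unfolding b_def by algebra
  have r: "degree r \<le> degree A"
    using degree_mod_less[OF assms(2), of "t * S"] by (auto simp: r_def)
  have "degree (S - r * B) \<le> n + degree A"
    using r assms(3-5) degree_mult_le[of r B] by (intro degree_diff_le) auto
  moreover have "S - r * B = A * b" using eq by (simp add: algebra_simps)
  ultimately have "degree (A * b) \<le> n + degree A" by simp
  then have "degree b \<le> n"
    using assms(2) by (cases "b = 0") (auto simp: degree_mult_eq)
  with eq r assms(4) show ?thesis
    by (metis degree_minus order_trans)
qed

lemma ex_cross_representation:
  fixes A B S :: "'a::{field_gcd} poly"
  assumes "coprime A B" "degree A \<le> n" "degree B \<le> n"
    and "degree S \<le> n + max (degree A) (degree B)"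
  shows "\<exists>a b. degree a \<le> n \<and> degree b \<le> n \<and> A * b - B * a = S"
proof (cases "A \<noteq> 0 \<and> degree B \<le> degree A")
  case True
  then show ?thesis
    using ex_cross_representation_dominant[of A B n S] assms by (simp add: max_absorb1)
next
  case False
  then have "B \<noteq> 0" "degree A \<le> degree B"
    using assms(1) by auto
  then obtain a b where "degree a \<le> n" "degree b \<le> n" "B * b - A * a = S"
    using ex_cross_representation_dominant[of B A n S] assms by (auto simp: max_absorb2 coprime_commute)
  then show ?thesis
    by (intro exI[of _ "- b"] exI[of _ "- a"]) (simp add: algebra_simps)
qed

text \<open>
  Where \<open>F\<close> vanishes the first-order term decides, elsewhere \<open>F\<close> itself does; compactness
  makes one \<open>\<epsilon>\<close> work for all points. The second-order term accounts for quadratic forms.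
\<close>

lemma perturbation_negative:
  fixes F G H :: "'a::metric_space \<Rightarrow> real"
  assumes K: "compact K"
    and cont: "continuous_on K F" "continuous_on K G" "continuous_on K H"
    and F: "\<And>x. x \<in> K \<Longrightarrow> F x \<le> 0"
    and G: "\<And>x. x \<in> K \<Longrightarrow> F x = 0 \<Longrightarrow> G x < 0"
  obtains \<epsilon> :: real where "\<epsilon> > 0" "\<And>x. x \<in> K \<Longrightarrow> F x + \<epsilon> * G x + \<epsilon>\<^sup>2 * H x < 0"
proof (rule ccontr)
  assume "\<not> thesis"
  then have "\<forall>\<epsilon>>0. \<exists>x\<in>K. F x + \<epsilon> * G x + \<epsilon>\<^sup>2 * H x \<ge> 0"
    using that by (meson not_le)
  then have "\<forall>k. \<exists>x\<in>K. F x + inverse (Suc k) * G x + (inverse (Suc k))\<^sup>2 * H x \<ge> 0"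
    by (metis inverse_positive_iff_positive of_nat_0_less_iff zero_less_Suc)
  then obtain x where x: "\<And>k. x k \<in> K"
    "\<And>k. F (x k) + inverse (Suc k) * G (x k) + (inverse (Suc k))\<^sup>2 * H (x k) \<ge> 0"
    by metis
  obtain l r where l: "l \<in> K" and r: "strict_mono (r :: nat \<Rightarrow> nat)" and lim: "(x \<circ> r) \<longlonglongrightarrow> l"
    using K x(1) unfolding compact_def by meson
  define d where "d k = inverse (real (Suc (r k)))" for k
  have d0: "d \<longlonglongrightarrow> 0"
    using LIMSEQ_subseq_LIMSEQ[OF LIMSEQ_inverse_real_of_nat r] by (simp add: d_def[abs_def] o_def)
  have tend: "(\<lambda>k. f (x (r k))) \<longlonglongrightarrow> f l" if "continuous_on K f" for f :: "'a \<Rightarrow> real"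
    using that l x(1) lim unfolding continuous_on_sequentially by (auto simp: o_def)
  have "(\<lambda>k. F (x (r k)) + d k * G (x (r k)) + (d k)\<^sup>2 * H (x (r k))) \<longlonglongrightarrow>
      F l + 0 * G l + 0\<^sup>2 * H l"
    by (intro tendsto_intros d0 tend cont)
  then have "0 \<le> F l + 0 * G l + 0\<^sup>2 * H l"
    by (rule LIMSEQ_le_const) (use x(2) in \<open>auto simp: d_def\<close>)
  then have "G l < 0"
    using F[OF l] G[OF l] by simp
  \<comment> \<open>Since \<open>F \<le> 0\<close>, dividing the assumed inequality by \<open>d k\<close> leaves a nonnegative value.\<close>
  have "(\<lambda>k. G (x (r k)) + d k * H (x (r k))) \<longlonglongrightarrow> G l + 0 * H l"
    by (intro tendsto_intros d0 tend cont)
  moreover have "0 \<le> G (x (r k)) + d k * H (x (r k))" for k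
  proof -
    have "0 \<le> d k * (G (x (r k)) + d k * H (x (r k)))"
      using x(2)[of "r k"] F[OF x(1), of "r k"]
      unfolding d_def[symmetric] by (simp add: algebra_simps power2_eq_square)
    moreover have "0 < d k" by (simp add: d_def)
    ultimately show ?thesis by (simp add: zero_le_mult_iff)
  qed
  ultimately have "0 \<le> G l + 0 * H l"
    by (intro LIMSEQ_le_const) auto
  with \<open>G l < 0\<close> show False by simp
qed

lemma approx_error_unitary_of_less:
  assumes "degree A \<le> n" "degree B \<le> n" "0 \<le> e"
    and neg: "\<And>x. x \<in> {-1..1} \<Longrightarrow> excess \<omega> e A B x < 0"
  shows "unitary_of A B \<in> unitary_rat n" "approx_error \<omega> (unitary_of A B) < e"
proof -
  have nz: "poly A x \<noteq> 0 \<or> poly B x \<noteq> 0" if "x \<in> {-1..1}" for x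
    using neg[OF that] by (auto simp: excess_def rot_Im_def rot_Re_def)
  from nz[of 0] have "A \<noteq> 0 \<or> B \<noteq> 0" by auto
  then show u: "unitary_of A B \<in> unitary_rat n"
    by (rule unitary_of_in_unitary_rat[OF assms(1,2)])
  obtain x where "x \<in> {-1..1}" "deviation \<omega> (unitary_of A B) x = approx_error \<omega> (unitary_of A B)"
    by (rule approx_error_attained[OF u])
  then show "approx_error \<omega> (unitary_of A B) < e"
    using deviation_less_iff[OF nz assms(3)] neg by metis
qed

definition extremal_points :: "real \<Rightarrow> complex poly fract \<Rightarrow> real set" where
  "extremal_points \<omega> u = {x\<in>{-1..1}. deviation \<omega> u x = approx_error \<omega> u}"

text \<open>
  At an extremal point the first-order change of the excess in direction \<open>(a, b)\<close> is
  \<open>2 e\<^sup>2 (X/Y) (A b - B a)\<close>. Both \<open>X\<close> and \<open>Y\<close> are nonzero there, because \<open>0 < e < 2\<close>. So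
  prescribing \<open>A b - B a = - X Y\<close> at the extremal points makes the change negative at all of them.
  The degree bound \<open>n + max (degree A) (degree B)\<close> for such cross polynomials is what limits the
  number of points.
\<close>

lemma ex_better_approximation:
  assumes cop: "coprime A B" and deg: "degree A \<le> n" "degree B \<le> n"
    and err: "0 < approx_error \<omega> (unitary_of A B)" "approx_error \<omega> (unitary_of A B) < 2"
    and fin: "finite (extremal_points \<omega> (unitary_of A B))"
    and card: "card (extremal_points \<omega> (unitary_of A B)) \<le> n + max (degree A) (degree B) + 1"
  shows "\<exists>v\<in>unitary_rat n. approx_error \<omega> v < approx_error \<omega> (unitary_of A B)"
proof -
  define u where "u = unitary_of A B"
  define e where "e = approx_error \<omega> u"
  have nz: "poly A x \<noteq> 0 \<or> poly B x \<noteq> 0" for x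
    by (rule coprime_no_common_root[OF cop])
  have u: "u \<in> unitary_rat n"
    unfolding u_def using nz[of 0] deg by (intro unitary_of_in_unitary_rat) auto
  have e: "0 < e" "e < 2" using err by (simp_all add: e_def u_def)
  obtain S where S: "degree S \<le> card (extremal_points \<omega> u) - 1"
    "\<forall>x\<in>extremal_points \<omega> u. poly S x = - (rot_Re \<omega> A B x * rot_Im \<omega> A B x)"
    using ex_interpolating_poly[OF fin[folded u_def],
        of "\<lambda>x. - (rot_Re \<omega> A B x * rot_Im \<omega> A B x)"] by blast
  have "degree S \<le> n + max (degree A) (degree B)"
    using S(1) card by (simp add: u_def)
  then obtain a b where ab: "degree a \<le> n" "degree b \<le> n" "A * b - B * a = S"
    using ex_cross_representation[OF cop deg] by blast
  define G where "G x = 2 * ((4 - e\<^sup>2) * rot_Im \<omega> A B x * rot_Im \<omega> a b x -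
      e\<^sup>2 * rot_Re \<omega> A B x * rot_Re \<omega> a b x)" for x
  have expand: "excess \<omega> e (A + [:\<epsilon>:] * a) (B + [:\<epsilon>:] * b) x =
      excess \<omega> e A B x + \<epsilon> * G x + \<epsilon>\<^sup>2 * excess \<omega> e a b x" for \<epsilon> x
    unfolding excess_def G_def rot_add rot_mult by simp algebra
  have "excess \<omega> e A B x \<le> 0" if "x \<in> {-1..1}" for x
    using deviation_le_approx_error[OF u that, of \<omega>] deviation_le_iff[OF nz, of e \<omega> x] e
    by (simp add: e_def u_def)
  moreover have "G x < 0" if x: "x \<in> {-1..1}" and eq: "excess \<omega> e A B x = 0" for x
  proof -
    define X Y where "X = rot_Re \<omega> A B x" and "Y = rot_Im \<omega> A B x"
    have "x \<in> extremal_points \<omega> u"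
      using x eq deviation_eq_iff[OF nz, of e \<omega> x] e by (simp add: extremal_points_def e_def u_def)
    then have cross: "X * rot_Im \<omega> a b x - Y * rot_Re \<omega> a b x = - (X * Y)"
      using S(2) ab(3) unfolding X_def Y_def rot_cross by (metis poly_diff poly_mult)
    have XY: "(4 - e\<^sup>2) * Y\<^sup>2 = e\<^sup>2 * X\<^sup>2"
      using eq unfolding excess_def X_def Y_def by (simp add: algebra_simps)
    \<comment> \<open>Multiplying by \<open>Y\<close> lets the extremality equation \<open>XY\<close> replace \<open>Y\<^sup>2\<close> by \<open>X\<^sup>2\<close>.\<close>
    have "Y * G x = 2 * (((4 - e\<^sup>2) * Y\<^sup>2) * rot_Im \<omega> a b x - e\<^sup>2 * X * Y * rot_Re \<omega> a b x)"
      unfolding G_def X_def Y_def by (simp add: algebra_simps power2_eq_square)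
    also have "\<dots> = 2 * e\<^sup>2 * X * (X * rot_Im \<omega> a b x - Y * rot_Re \<omega> a b x)"
      unfolding XY by (simp add: algebra_simps power2_eq_square)
    finally have YG: "Y * G x = - 2 * e\<^sup>2 * X\<^sup>2 * Y"
      unfolding cross by (simp add: power2_eq_square)
    have "e\<^sup>2 < 2\<^sup>2" using e by (intro power_strict_mono) auto
    have "X\<^sup>2 + Y\<^sup>2 \<noteq> 0"
      unfolding X_def Y_def rot_sum_squares using nz[of x] by (simp add: sum_power2_eq_zero_iff)
    then have "X \<noteq> 0" "Y \<noteq> 0"
      using XY e \<open>e\<^sup>2 < 2\<^sup>2\<close> by auto
    have "Y * (G x + 2 * e\<^sup>2 * X\<^sup>2) = 0"
      using YG by (simp add: algebra_simps)
    then have "G x = - (2 * e\<^sup>2 * X\<^sup>2)"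
      using \<open>Y \<noteq> 0\<close> by simp
    then show "G x < 0"
      using \<open>X \<noteq> 0\<close> e by simp
  qed
  moreover have "continuous_on {-1..1} G"
    unfolding G_def by (intro continuous_intros)
  ultimately obtain \<epsilon> where \<epsilon>:
    "\<And>x. x \<in> {-1..1} \<Longrightarrow> excess \<omega> e A B x + \<epsilon> * G x + \<epsilon>\<^sup>2 * excess \<omega> e a b x < 0"
    using perturbation_negative[OF compact_Icc continuous_on_excess _ continuous_on_excess]
    by metis
  have "degree (A + [:\<epsilon>:] * a) \<le> n" "degree (B + [:\<epsilon>:] * b) \<le> n"
    using deg ab by (auto intro!: degree_add_le degree_smult_le[THEN order_trans])
  moreover have "excess \<omega> e (A + [:\<epsilon>:] * a) (B + [:\<epsilon>:] * b) x < 0" if "x \<in> {-1..1}" for x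
    unfolding expand by (rule \<epsilon>[OF that])
  ultimately show ?thesis
    using approx_error_unitary_of_less[of _ n _ e \<omega>] e(1) unfolding e_def u_def
    by (metis less_imp_le)
qed

text \<open>
  Writing \<open>\<theta>\<close> for the argument of \<open>exp(i \<omega> x/2) (A + i B)\<close>, this is \<open>\<theta>' (A\<^sup>2 + B\<^sup>2)\<close>. The deviation
  is \<open>2 \<bar>sin \<theta>\<bar>\<close>, so its interior maxima below 2 occur at zeros of \<open>\<theta>'\<close>.
\<close>

definition critical_poly :: "real \<Rightarrow> real poly \<Rightarrow> real poly \<Rightarrow> real poly" where
  "critical_poly \<omega> A B = smult (\<omega> / 2) (A\<^sup>2 + B\<^sup>2) + (A * pderiv B - B * pderiv A)"

lemma degree_critical_poly: "degree (critical_poly \<omega> A B) \<le> 2 * max (degree A) (degree B)"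
proof -
  define m where "m = max (degree A) (degree B)"
  have "degree A \<le> m" "degree B \<le> m" "degree (pderiv A) \<le> m" "degree (pderiv B) \<le> m"
    by (auto simp: m_def degree_pderiv)
  then show ?thesis
    unfolding critical_poly_def m_def[symmetric] power2_eq_square
    by (intro degree_add_le degree_diff_le degree_smult_le[THEN order_trans]
        degree_mult_le[THEN order_trans]) auto
qed

text \<open>
  The coefficient at twice the maximal degree \<open>m\<close> is \<open>\<omega>/2\<close> times the sum of the squares of the
  coefficients of \<open>A\<close> and \<open>B\<close> at \<open>m\<close>, one of which is a leading coefficient; the derivative terms
  have smaller degree.
\<close>

lemma critical_poly_nonzero:
  assumes "\<omega> \<noteq> 0" "A \<noteq> 0 \<or> B \<noteq> 0"
  shows "critical_poly \<omega> A B \<noteq> 0"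
proof
  define m where "m = max (degree A) (degree B)"
  assume zero: "critical_poly \<omega> A B = 0"
  have m_ge: "degree A \<le> m" "degree B \<le> m" by (simp_all add: m_def)
  have sq: "coeff (P * P) (m + m) = (coeff P m)\<^sup>2" if "degree P \<le> m" for P :: "real poly"
    using that by (cases "degree P = m")
      (auto simp: coeff_mult_degree_sum coeff_eq_0 power2_eq_square
        intro!: coeff_eq_0 order.strict_trans1[OF degree_mult_le])
  have cross: "coeff (P * pderiv Q) (m + m) = 0" if "degree P \<le> m" "degree Q \<le> m"
    for P Q :: "real poly"
  proof (cases "degree Q = 0")
    case True
    then have "pderiv Q = 0" by (simp add: pderiv_eq_0_iff)
    then show ?thesis by simp
  next
    case False
    then show ?thesis
      using that degree_mult_le[of P "pderiv Q"] by (intro coeff_eq_0) (simp add: degree_pderiv)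
  qed
  have "coeff (critical_poly \<omega> A B) (m + m) = \<omega> / 2 * ((coeff A m)\<^sup>2 + (coeff B m)\<^sup>2)"
    by (simp add: critical_poly_def power2_eq_square[of A] power2_eq_square[of B] sq cross
        m_def[symmetric] m_ge)
  then have "coeff A m = 0 \<and> coeff B m = 0"
    using zero assms(1) by (simp add: sum_power2_eq_zero_iff)
  moreover have "m = degree A \<or> m = degree B" by (auto simp: m_def)
  ultimately have "A = 0 \<or> B = 0"
    by (metis leading_coeff_0_iff)
  then show False
    using \<open>coeff A m = 0 \<and> coeff B m = 0\<close> assms(2) unfolding m_def
    by (metis degree_0 leading_coeff_0_iff max_0L max_0R)
qed

lemma has_field_derivative_rot:
  "(rot_Re \<omega> A B has_real_derivative rot_Re \<omega> (pderiv A) (pderiv B) x - \<omega> / 2 * rot_Im \<omega> A B x) (at x)"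
  "(rot_Im \<omega> A B has_real_derivative rot_Im \<omega> (pderiv A) (pderiv B) x + \<omega> / 2 * rot_Re \<omega> A B x) (at x)"
  unfolding rot_Re_def[abs_def] rot_Im_def[abs_def]
  by (auto intro!: derivative_eq_intros simp: algebra_simps)

lemma poly_critical_poly:
  "poly (critical_poly \<omega> A B) x =
    rot_Re \<omega> A B x * (rot_Im \<omega> (pderiv A) (pderiv B) x + \<omega> / 2 * rot_Re \<omega> A B x) -
    rot_Im \<omega> A B x * (rot_Re \<omega> (pderiv A) (pderiv B) x - \<omega> / 2 * rot_Im \<omega> A B x)"
proof -
  have "poly (critical_poly \<omega> A B) x =
      \<omega> / 2 * ((rot_Re \<omega> A B x)\<^sup>2 + (rot_Im \<omega> A B x)\<^sup>2) +
      (rot_Re \<omega> A B x * rot_Im \<omega> (pderiv A) (pderiv B) x -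
       rot_Im \<omega> A B x * rot_Re \<omega> (pderiv A) (pderiv B) x)"
    unfolding rot_sum_squares rot_cross by (simp add: critical_poly_def)
  then show ?thesis by (simp add: algebra_simps power2_eq_square)
qed

text \<open>
  At an interior maximum the derivative of the excess vanishes; combined with the vanishing of the
  excess this is \<open>e\<^sup>2 X (X Y' - Y X') = 0\<close>. For \<open>e = 0\<close> this is void, but then \<open>Y\<close> vanishes
  identically on the segment, so that \<open>Y' = 0\<close>.
\<close>

lemma critical_poly_root:
  assumes nz: "\<And>x. poly A x \<noteq> 0 \<or> poly B x \<noteq> 0" and e: "0 \<le> e" "e < 2"
    and le: "\<And>y. y \<in> {-1..1} \<Longrightarrow> excess \<omega> e A B y \<le> 0"
    and x: "-1 < x" "x < 1" and eq: "excess \<omega> e A B x = 0"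
  shows "poly (critical_poly \<omega> A B) x = 0"
proof -
  have max_at: "f' = 0" if "(f has_real_derivative f') (at x)"
    "\<And>y. y \<in> {-1..1} \<Longrightarrow> f y \<le> f x" for f f'
  proof (rule DERIV_local_max[OF that(1)])
    show "0 < min (x + 1) (1 - x)" using x by simp
    show "\<forall>y. \<bar>x - y\<bar> < min (x + 1) (1 - x) \<longrightarrow> f y \<le> f x"
      by (intro allI impI that(2)) (simp add: abs_less_iff)
  qed
  define X Y X' Y' where "X = rot_Re \<omega> A B x" and "Y = rot_Im \<omega> A B x"
    and "X' = rot_Re \<omega> (pderiv A) (pderiv B) x - \<omega> / 2 * Y"
    and "Y' = rot_Im \<omega> (pderiv A) (pderiv B) x + \<omega> / 2 * X"
  have crit: "poly (critical_poly \<omega> A B) x = X * Y' - Y * X'"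
    unfolding poly_critical_poly X'_def Y'_def X_def Y_def ..
  show ?thesis
  proof (cases "e = 0")
    case True
    then have zero: "rot_Im \<omega> A B y = 0" if "y \<in> {-1..1}" for y
      using le[OF that] by (simp add: excess_def)
    have "Y' = 0"
      unfolding Y'_def X_def
      by (rule max_at[OF has_field_derivative_rot(2)]) (use zero x in simp)
    then show ?thesis
      unfolding crit Y_def using zero x by simp
  next
    case False
    have "(excess \<omega> e A B has_real_derivative
        4 * (2 * Y * Y') - e\<^sup>2 * (2 * X * X' + 2 * Y * Y')) (at x)"
      unfolding excess_def[abs_def] X'_def Y'_def unfolding X_def Y_def
      by (auto intro!: derivative_eq_intros has_field_derivative_rot)
    then have deriv: "4 * (2 * Y * Y') - e\<^sup>2 * (2 * X * X' + 2 * Y * Y') = 0"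
      by (rule max_at) (use le eq in simp)
    have XY: "(4 - e\<^sup>2) * Y\<^sup>2 = e\<^sup>2 * X\<^sup>2"
      using eq unfolding excess_def X_def Y_def by (simp add: algebra_simps)
    have "e\<^sup>2 * X * (X * Y' - Y * X') = (e\<^sup>2 * X\<^sup>2) * Y' - e\<^sup>2 * X * X' * Y"
      by (simp add: algebra_simps power2_eq_square)
    also have "\<dots> = ((4 - e\<^sup>2) * (Y * Y') - e\<^sup>2 * (X * X')) * Y"
      unfolding XY[symmetric] by (simp add: algebra_simps power2_eq_square)
    also have "(4 - e\<^sup>2) * (Y * Y') - e\<^sup>2 * (X * X') = 0"
      using deriv by (simp add: algebra_simps)
    finally have "e\<^sup>2 * X * (X * Y' - Y * X') = 0" by simp
    moreover have "X \<noteq> 0"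
    proof
      assume "X = 0"
      have "e\<^sup>2 < 2\<^sup>2" using e by (intro power_strict_mono) auto
      with XY \<open>X = 0\<close> have "X\<^sup>2 + Y\<^sup>2 = 0" by auto
      then show False
        unfolding X_def Y_def rot_sum_squares using nz[of x] by (simp add: sum_power2_eq_zero_iff)
    qed
    ultimately show ?thesis
      unfolding crit using False by simp
  qed
qed

section \<open>Counting the extremal points of a minimizer\<close>

text \<open>
  Let \<open>m\<close> be the larger degree. A minimizer cannot be improved, so it has at least \<open>n + m + 2\<close>
  extremal points; all but the two endpoints are roots of the critical polynomial, so there are at
  most \<open>2 m + 2\<close>. Hence \<open>m = n\<close>, and the lower bound becomes \<open>2 n + 2\<close>.
\<close>

lemma extremal_points_of_minimizer:
  assumes cop: "coprime A B" and deg: "degree A \<le> n" "degree B \<le> n"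
    and \<omega>: "\<omega> \<noteq> 0" and less: "approx_error \<omega> (unitary_of A B) < 2"
    and minimal: "\<And>v. v \<in> unitary_rat n \<Longrightarrow> approx_error \<omega> (unitary_of A B) \<le> approx_error \<omega> v"
  shows "2 * n + 2 \<le> card (extremal_points \<omega> (unitary_of A B))"
    and "max (degree A) (degree B) = n"
proof -
  define u e m where "u = unitary_of A B" and "e = approx_error \<omega> u"
    and "m = max (degree A) (degree B)"
  have nz: "poly A x \<noteq> 0 \<or> poly B x \<noteq> 0" for x
    by (rule coprime_no_common_root[OF cop])
  have nz': "A \<noteq> 0 \<or> B \<noteq> 0" using nz[of 0] by auto
  have u: "u \<in> unitary_rat n"
    unfolding u_def by (rule unitary_of_in_unitary_rat[OF deg nz'])
  have e: "0 \<le> e" "e < 2"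
    using approx_error_nonneg[OF u] less by (simp_all add: e_def u_def)
  let ?D = "critical_poly \<omega> A B"
  have D: "?D \<noteq> 0" by (rule critical_poly_nonzero[OF \<omega> nz'])
  have le: "excess \<omega> e A B y \<le> 0" if "y \<in> {-1..1}" for y
    using deviation_le_approx_error[OF u that, of \<omega>] deviation_le_iff[OF nz e(1), of \<omega> y]
    by (simp add: e_def u_def)
  have "poly ?D x = 0" if "x \<in> extremal_points \<omega> u" "x \<noteq> -1" "x \<noteq> 1" for x
    using that deviation_eq_iff[OF nz e(1), of \<omega> x]
    by (intro critical_poly_root[OF nz e le]) (auto simp: extremal_points_def e_def u_def)
  then have sub: "extremal_points \<omega> u \<subseteq> {-1, 1} \<union> {x. poly ?D x = 0}" by blast
  have fin: "finite ({-1, 1} \<union> {x. poly ?D x = 0})"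
    using poly_roots_finite[OF D] by simp
  have finite: "finite (extremal_points \<omega> (unitary_of A B))"
    using finite_subset[OF sub fin] by (simp add: u_def)
  have "card (extremal_points \<omega> u) \<le> card ({-1, 1} \<union> {x. poly ?D x = 0})"
    by (rule card_mono[OF fin sub])
  also have "\<dots> \<le> card {-1, 1::real} + card {x. poly ?D x = 0}"
    by (rule card_Un_le)
  also have "\<dots> \<le> 2 + 2 * m"
    using card_poly_roots_bound[OF D] degree_critical_poly[of \<omega> A B] by (simp add: m_def)
  finally have upper: "card (extremal_points \<omega> u) \<le> 2 + 2 * m" .
  \<comment> \<open>For \<open>e = 0\<close> every point of the segment would be extremal.\<close>
  have "e \<noteq> 0"
  proof
    assume "e = 0"
    then have "{-1..1} \<subseteq> extremal_points \<omega> u"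
      using deviation_le_approx_error[OF u, of _ \<omega>]
      by (auto simp: extremal_points_def e_def deviation_def intro: antisym)
    then have "finite {-1..1::real}"
      using finite unfolding u_def by (rule finite_subset)
    then show False
      using infinite_Icc[of "-1" "1::real"] by simp
  qed
  then have "0 < approx_error \<omega> (unitary_of A B)"
    using e(1) by (simp add: e_def u_def)
  then have "\<not> card (extremal_points \<omega> (unitary_of A B)) \<le> n + max (degree A) (degree B) + 1"
    using ex_better_approximation[OF cop deg _ less finite] minimal by (meson not_less)
  then have lower: "n + m + 2 \<le> card (extremal_points \<omega> u)"
    by (simp add: m_def u_def)
  then show "max (degree A) (degree B) = n"
    using upper deg by (simp add: m_def)
  then show "2 * n + 2 \<le> card (extremal_points \<omega> (unitary_of A B))"
    using lower by (simp add: m_def u_def)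
qed

section \<open>Frequencies below \<open>(n + 1) \<pi>\<close>\<close>

text \<open>
  The product changes sign exactly where the sine does. In the induction the last period is moved
  back by \<open>\<pi>\<close>: the sine changes sign, and so does the product, through the factor for \<open>j = 1\<close>.
\<close>

lemma sin_times_root_product_nonneg:
  assumes "0 \<le> y" "y \<le> (real n + 1) * pi"
  shows "0 \<le> sin y * (\<Prod>j\<in>{1..n}. real j * pi - y)"
  using assms
proof (induction n arbitrary: y)
  case 0
  then show ?case by (simp add: sin_ge_zero)
next
  case (Suc n)
  show ?case
  proof (cases "y \<le> (real n + 1) * pi")
    case True
    then have "0 \<le> (sin y * (\<Prod>j\<in>{1..n}. real j * pi - y)) * (real (Suc n) * pi - y)"
      using Suc.IH[of y] Suc.prems(1) by (intro mult_nonneg_nonneg[OF Suc.IH]) (auto simp: algebra_simps)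
    then show ?thesis by (simp add: mult_ac)
  next
    case False
    define z where "z = y - pi"
    have "pi \<le> (real n + 1) * pi" by (simp add: algebra_simps)
    then have "pi \<le> y" using False by linarith
    then have z: "0 \<le> z" "z \<le> (real n + 1) * pi"
      using Suc.prems by (simp_all add: z_def algebra_simps)
    have "sin y = - sin z" by (simp add: z_def sin_diff)
    have "(\<Prod>j\<in>{1..Suc n}. real j * pi - y) = (\<Prod>j\<in>{0..n}. real j * pi - z)"
      unfolding One_nat_def prod.shift_bounds_cl_Suc_ivl by (simp add: z_def algebra_simps)
    also have "\<dots> = (0 - z) * (\<Prod>j\<in>{1..n}. real j * pi - z)"
      by (subst prod.atLeast_Suc_atMost) auto
    finally have "sin y * (\<Prod>j\<in>{1..Suc n}. real j * pi - y) =
        z * (sin z * (\<Prod>j\<in>{1..n}. real j * pi - z))"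
      using \<open>sin y = - sin z\<close> by simp
    then show ?thesis
      using Suc.IH[OF z] z by simp
  qed
qed

text \<open>
  A pair with \<open>X > 0\<close> on the segment is needed. In the variable \<open>y = \<alpha> + \<omega> x/2\<close>, which stays
  strictly between \<open>0\<close> and \<open>(n + 1) \<pi>\<close>, a suitable choice of \<open>(A, B)\<close> gives
  \<open>X = sin y P + \<epsilon> cos y Q\<close>. With \<open>P\<close> vanishing at the zeros of the sine the first term is
  nonnegative, and with \<open>Q\<close> equal to the cosine at these zeros the second one is positive where
  the first one vanishes.
\<close>

lemma ex_approx_error_less_2:
  assumes "0 < \<omega>" "\<omega> < (real n + 1) * pi"
  shows "\<exists>v\<in>unitary_rat n. approx_error \<omega> v < 2"
proof -
  define \<alpha> where "\<alpha> = (real n + 1) * pi / 2"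
  define y where "y x = \<alpha> + \<omega> / 2 * x" for x
  have y: "0 < y x" "y x < (real n + 1) * pi" if "x \<in> {-1..1}" for x
  proof -
    have "\<bar>\<omega> / 2 * x\<bar> \<le> \<omega> / 2 * 1"
      unfolding abs_mult using that assms by (intro mult_mono) auto
    then show "0 < y x" "y x < (real n + 1) * pi"
      using assms by (auto simp: y_def \<alpha>_def)
  qed
  define N where "N = (\<Prod>j\<in>{1..n}. [:real j * pi, - 1:])"
  define Z where "Z = (\<lambda>j. real j * pi) ` {1..n}"
  obtain M where M: "degree M \<le> card Z - 1" "\<forall>z\<in>Z. poly M z = cos z"
    using ex_interpolating_poly[of Z cos] by (auto simp: Z_def)
  have "degree M \<le> n"
    using M(1) card_image_le[of "{1..n}" "\<lambda>j. real j * pi"] by (simp add: Z_def)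
  define P Q where "P = pcompose N [:\<alpha>, \<omega> / 2:]" and "Q = pcompose M [:\<alpha>, \<omega> / 2:]"
  have N: "poly N t = (\<Prod>j\<in>{1..n}. real j * pi - t)" for t
    by (simp add: N_def poly_prod)
  have P: "poly P x = (\<Prod>j\<in>{1..n}. real j * pi - y x)" and Q: "poly Q x = poly M (y x)" for x
    by (simp_all add: P_def Q_def poly_pcompose N y_def mult.commute)
  have "degree N \<le> n"
    unfolding N_def using degree_prod_sum_le[of "{1..n}" "\<lambda>j. [:real j * pi, - 1:]"] by simp
  then have deg: "degree P \<le> n" "degree Q \<le> n"
    using \<open>degree M \<le> n\<close> assms by (simp_all add: P_def Q_def degree_pcompose)
  have F: "- (sin (y x) * poly P x) \<le> 0" if "x \<in> {-1..1}" for x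
    using sin_times_root_product_nonneg[of "y x" n] y[OF that] by (simp add: P)
  have G: "- (cos (y x) * poly Q x) < 0"
    if "x \<in> {-1..1}" and zero: "- (sin (y x) * poly P x) = 0" for x
  proof -
    have "\<exists>j\<in>{1..n}. y x = real j * pi"
    proof (cases "sin (y x) = 0")
      case True
      then obtain i :: int where i: "y x = of_int i * pi"
        by (auto simp: sin_zero_iff_int2)
      then have "0 < i" "i < int n + 1"
        using y[OF that(1)] by (auto simp: zero_less_mult_iff)
      then show ?thesis
        using i by (intro bexI[of _ "nat i"]) auto
    next
      case False
      then show ?thesis using zero by (auto simp: P eq_commute[of "y x"])
    qed
    then have "y x \<in> Z" "cos (y x) \<noteq> 0"
      by (auto simp: Z_def)
    then show ?thesis
      using M(2) by (simp add: Q flip: power2_eq_square)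
  qed
  have cont: "continuous_on {-1..1} (\<lambda>x. - (sin (y x) * poly P x))"
    "continuous_on {-1..1} (\<lambda>x. - (cos (y x) * poly Q x))"
    unfolding y_def by (intro continuous_intros)+
  obtain \<epsilon> :: real where "\<epsilon> > 0" and \<epsilon>: "\<And>x. x \<in> {-1..1} \<Longrightarrow>
      - (sin (y x) * poly P x) + \<epsilon> * - (cos (y x) * poly Q x) + \<epsilon>\<^sup>2 * 0 < 0"
    using perturbation_negative[OF compact_Icc cont continuous_on_const[where c = 0] F G] by blast
  \<comment> \<open>The addition theorems for \<open>sin (\<alpha> + \<omega> x/2)\<close> and \<open>cos (\<alpha> + \<omega> x/2)\<close> dictate these coefficients.\<close>
  define A where "A = smult (sin \<alpha>) P + smult (\<epsilon> * cos \<alpha>) Q"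
  define B where "B = smult (- cos \<alpha>) P + smult (\<epsilon> * sin \<alpha>) Q"
  have "rot_Re \<omega> A B x = sin (y x) * poly P x + \<epsilon> * cos (y x) * poly Q x" for x
    by (simp add: rot_Re_def A_def B_def y_def sin_add cos_add algebra_simps)
  then have "excess \<omega> 2 A B x < 0" if "x \<in> {-1..1}" for x
    using \<epsilon>[OF that] by (simp add: excess_def algebra_simps)
  moreover have "degree A \<le> n" "degree B \<le> n"
    unfolding A_def B_def using deg
    by (intro degree_add_le degree_smult_le[THEN order_trans]; simp)+
  ultimately show ?thesis
    using approx_error_unitary_of_less[of A n B 2 \<omega>] by auto
qed

section \<open>Uniqueness\<close>

lemma rot_minus: "rot_Re \<omega> (- A) (- B) x = - rot_Re \<omega> A B x"
  by (simp add: rot_Re_def)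

text \<open>
  An error below 2 excludes \<open>X = 0\<close>. By connectedness \<open>X\<close> has constant sign, and negating both
  polynomials does not change the rational function.
\<close>

lemma positive_coprime_pair:
  assumes u: "u \<in> unitary_rat n" and less: "approx_error \<omega> u < 2"
  obtains A B where "u = unitary_of A B" "coprime A B" "degree A \<le> n" "degree B \<le> n"
    "\<And>x. x \<in> {-1..1} \<Longrightarrow> 0 < rot_Re \<omega> A B x"
proof -
  obtain A B where AB: "u = unitary_of A B" "coprime A B" "degree A \<le> n" "degree B \<le> n"
    by (rule unitary_rat_coprime_pair[OF u])
  have nz: "poly A x \<noteq> 0 \<or> poly B x \<noteq> 0" for x
    by (rule coprime_no_common_root[OF AB(2)])
  have "rot_Re \<omega> A B x \<noteq> 0" if "x \<in> {-1..1}" for x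
  proof -
    have "excess \<omega> 2 A B x < 0"
      using deviation_le_approx_error[OF u that, of \<omega>] less deviation_less_iff[OF nz, of 2 \<omega> x]
      by (simp add: AB(1))
    then show ?thesis by (auto simp: excess_def)
  qed
  then have zero: "0 \<notin> rot_Re \<omega> A B ` {-1..1}" by auto
  have conn: "connected (rot_Re \<omega> A B ` {-1..1})"
    by (intro connected_continuous_image continuous_on_rot) simp
  show thesis
  proof (cases "rot_Re \<omega> A B 0 > 0")
    case True
    have "0 < rot_Re \<omega> A B x" if "x \<in> {-1..1}" for x
      using connectedD_interval[OF conn, of "rot_Re \<omega> A B x" "rot_Re \<omega> A B 0" 0] True zero that
      by (force simp: not_less[symmetric])
    then show thesis using that AB by blast
  next
    case False
    have "0 < rot_Re \<omega> (- A) (- B) x" if "x \<in> {-1..1}" for x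
      using connectedD_interval[OF conn, of "rot_Re \<omega> A B 0" "rot_Re \<omega> A B x" 0] False zero that
      by (force simp: not_less[symmetric] rot_minus)
    moreover have "u = unitary_of (- A) (- B)"
      unfolding AB(1) using nz[of 0] by (subst unitary_of_eq_iff) auto
    ultimately show thesis using that[of "- A" "- B"] AB by simp
  qed
qed

text \<open>
  Taking square roots in \<open>(4 - e\<^sup>2) Y\<^sup>2 \<le> e\<^sup>2 X\<^sup>2\<close>. The resulting condition is stable under addition
  of pairs.
\<close>

lemma excess_linear:
  assumes "0 \<le> e" "e < 2" "0 < rot_Re \<omega> A B x"
  shows excess_le_iff_linear:
      "excess \<omega> e A B x \<le> 0 \<longleftrightarrow> sqrt (4 - e\<^sup>2) * \<bar>rot_Im \<omega> A B x\<bar> \<le> e * rot_Re \<omega> A B x"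
    and excess_eq_iff_linear:
      "excess \<omega> e A B x = 0 \<longleftrightarrow> sqrt (4 - e\<^sup>2) * \<bar>rot_Im \<omega> A B x\<bar> = e * rot_Re \<omega> A B x"
proof -
  have "e\<^sup>2 < 2\<^sup>2" using assms by (intro power_strict_mono) auto
  then have eq: "excess \<omega> e A B x =
      (sqrt (4 - e\<^sup>2) * \<bar>rot_Im \<omega> A B x\<bar>)\<^sup>2 - (e * rot_Re \<omega> A B x)\<^sup>2"
    by (simp add: excess_def power_mult_distrib algebra_simps)
  have nonneg: "0 \<le> sqrt (4 - e\<^sup>2) * \<bar>rot_Im \<omega> A B x\<bar>" "0 \<le> e * rot_Re \<omega> A B x"
    using assms \<open>e\<^sup>2 < 2\<^sup>2\<close> by auto
  show "excess \<omega> e A B x \<le> 0 \<longleftrightarrow> sqrt (4 - e\<^sup>2) * \<bar>rot_Im \<omega> A B x\<bar> \<le> e * rot_Re \<omega> A B x"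
    unfolding eq using nonneg by (simp add: power2_le_iff_abs_le)
  show "excess \<omega> e A B x = 0 \<longleftrightarrow> sqrt (4 - e\<^sup>2) * \<bar>rot_Im \<omega> A B x\<bar> = e * rot_Re \<omega> A B x"
    unfolding eq using nonneg by (simp add: power2_eq_iff_nonneg)
qed

text \<open>
  The set of pairs with \<open>X > 0\<close> and error at most \<open>e\<close> is closed under addition, so the sum of the
  pairs of two minimizers yields a third minimizer. Equality for the sum at an extremal point forces
  equality with the same sign for both summands, which makes \<open>(X, Y)\<close> and \<open>(X', Y')\<close> parallel.
\<close>

lemma minimizer_unique:
  assumes u: "u \<in> unitary_rat n" and v: "v \<in> unitary_rat n"
    and u_min: "\<And>w. w \<in> unitary_rat n \<Longrightarrow> approx_error \<omega> u \<le> approx_error \<omega> w"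
    and v_min: "\<And>w. w \<in> unitary_rat n \<Longrightarrow> approx_error \<omega> v \<le> approx_error \<omega> w"
    and \<omega>: "\<omega> \<noteq> 0" and less: "approx_error \<omega> u < 2"
  shows "u = v"
proof -
  define e where "e = approx_error \<omega> u"
  have ev: "approx_error \<omega> v = e"
    using u_min[OF v] v_min[OF u] by (simp add: e_def)
  have e: "0 \<le> e" "e < 2"
    using approx_error_nonneg[OF u] less by (simp_all add: e_def)
  then have c: "0 < sqrt (4 - e\<^sup>2)"
    using power_strict_mono[of e 2 2] by simp
  obtain A B where AB: "u = unitary_of A B" "coprime A B" "degree A \<le> n" "degree B \<le> n"
    and pos: "\<And>x. x \<in> {-1..1} \<Longrightarrow> 0 < rot_Re \<omega> A B x"
    using positive_coprime_pair[OF u less] by blast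
  obtain A' B' where AB': "v = unitary_of A' B'" "coprime A' B'" "degree A' \<le> n" "degree B' \<le> n"
    and pos': "\<And>x. x \<in> {-1..1} \<Longrightarrow> 0 < rot_Re \<omega> A' B' x"
    using positive_coprime_pair[OF v, of \<omega>] ev e(2) by blast
  have le: "sqrt (4 - e\<^sup>2) * \<bar>rot_Im \<omega> A B x\<bar> \<le> e * rot_Re \<omega> A B x" if "x \<in> {-1..1}" for x
    using deviation_le_approx_error[OF u that, of \<omega>] excess_le_iff_linear[OF e pos[OF that]]
      deviation_le_iff[OF coprime_no_common_root[OF AB(2)] e(1), of \<omega> x]
    by (simp add: AB(1) e_def)
  have le': "sqrt (4 - e\<^sup>2) * \<bar>rot_Im \<omega> A' B' x\<bar> \<le> e * rot_Re \<omega> A' B' x" if "x \<in> {-1..1}" for x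
    using deviation_le_approx_error[OF v that, of \<omega>] excess_le_iff_linear[OF e pos'[OF that]]
      deviation_le_iff[OF coprime_no_common_root[OF AB'(2)] e(1), of \<omega> x]
    by (simp add: AB'(1) ev[unfolded AB'(1)])
  define w where "w = unitary_of (A + A') (B + B')"
  have pos_sum: "0 < rot_Re \<omega> (A + A') (B + B') x" if "x \<in> {-1..1}" for x
    unfolding rot_add using pos[OF that] pos'[OF that] by simp
  then have nz: "poly (A + A') x \<noteq> 0 \<or> poly (B + B') x \<noteq> 0" if "x \<in> {-1..1}" for x
    using that by (force simp: rot_Re_def)
  from nz[of 0] have "A + A' \<noteq> 0 \<or> B + B' \<noteq> 0" by (auto simp del: poly_add)
  then have w: "w \<in> unitary_rat n"
    unfolding w_def using AB AB' by (intro unitary_of_in_unitary_rat degree_add_le) auto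
  have "deviation \<omega> w x \<le> e" if x: "x \<in> {-1..1}" for x
  proof -
    have "sqrt (4 - e\<^sup>2) * \<bar>rot_Im \<omega> A B x + rot_Im \<omega> A' B' x\<bar> \<le>
        sqrt (4 - e\<^sup>2) * (\<bar>rot_Im \<omega> A B x\<bar> + \<bar>rot_Im \<omega> A' B' x\<bar>)"
      using c by (intro mult_left_mono abs_triangle_ineq) auto
    also have "\<dots> \<le> e * (rot_Re \<omega> A B x + rot_Re \<omega> A' B' x)"
      using le[OF x] le'[OF x] by (simp add: algebra_simps)
    finally show ?thesis
      unfolding w_def deviation_le_iff[OF nz[OF x] e(1)] excess_le_iff_linear[OF e pos_sum[OF x]]
      by (simp add: rot_add)
  qed
  then have "approx_error \<omega> w \<le> e"
    by (simp add: approx_error_le_iff[OF w])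
  then have ew: "approx_error \<omega> w = e"
    using u_min[OF w] by (simp add: e_def)
  \<comment> \<open>The sum may have a common factor, so the count is applied to a coprime representative.\<close>
  obtain A\<^sub>3 B\<^sub>3 where AB3: "w = unitary_of A\<^sub>3 B\<^sub>3" "coprime A\<^sub>3 B\<^sub>3" "degree A\<^sub>3 \<le> n" "degree B\<^sub>3 \<le> n"
    by (rule unitary_rat_coprime_pair[OF w])
  have w_min: "approx_error \<omega> (unitary_of A\<^sub>3 B\<^sub>3) \<le> approx_error \<omega> z" if "z \<in> unitary_rat n" for z
    using u_min[OF that] ew AB3(1) by (simp add: e_def)
  have card: "2 * n + 2 \<le> card (extremal_points \<omega> w)"
    using extremal_points_of_minimizer(1)[OF AB3(2-4) \<omega> _ w_min] ew e(2) AB3(1) by simp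
  have root: "poly (A * B' - B * A') x = 0" if "x \<in> extremal_points \<omega> w" for x
  proof -
    define X Y X' Y' c where "X = rot_Re \<omega> A B x" and "Y = rot_Im \<omega> A B x"
      and "X' = rot_Re \<omega> A' B' x" and "Y' = rot_Im \<omega> A' B' x" and "c = sqrt (4 - e\<^sup>2)"
    have x: "x \<in> {-1..1}" and dev: "deviation \<omega> w x = e"
      using that by (auto simp: extremal_points_def ew)
    have "c * \<bar>Y + Y'\<bar> = e * (X + X')"
      using dev unfolding w_def deviation_eq_iff[OF nz[OF x] e(1)]
        excess_eq_iff_linear[OF e pos_sum[OF x]] rot_add X_def Y_def X'_def Y'_def c_def .
    moreover have "c * \<bar>Y\<bar> \<le> e * X" "c * \<bar>Y'\<bar> \<le> e * X'"
      using le[OF x] le'[OF x] by (simp_all add: X_def Y_def X'_def Y'_def c_def)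
    moreover have "c > 0" using c by (simp add: c_def)
    moreover have "c * Y \<le> c * \<bar>Y\<bar>" "c * Y' \<le> c * \<bar>Y'\<bar>" "- (c * Y) \<le> c * \<bar>Y\<bar>" "- (c * Y') \<le> c * \<bar>Y'\<bar>"
      using \<open>c > 0\<close> abs_ge_self[of "c * Y"] abs_ge_minus_self[of "c * Y"]
        abs_ge_self[of "c * Y'"] abs_ge_minus_self[of "c * Y'"] by (simp_all add: abs_mult)
    moreover have "c * \<bar>Y + Y'\<bar> = c * Y + c * Y' \<or> c * \<bar>Y + Y'\<bar> = - (c * Y) - c * Y'"
      by (cases "0 \<le> Y + Y'") (simp_all add: algebra_simps)
    \<comment> \<open>Equality in the triangle inequality.\<close>
    ultimately have "c * Y = e * X \<and> c * Y' = e * X' \<or> c * Y = - (e * X) \<and> c * Y' = - (e * X')"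
      unfolding distrib_left by linarith
    then have "c * (X * Y' - Y * X') = 0"
    proof
      assume h: "c * Y = e * X \<and> c * Y' = e * X'"
      have "c * (X * Y' - Y * X') = X * (c * Y') - (c * Y) * X'" by (simp add: algebra_simps)
      then show ?thesis using h by simp
    next
      assume h: "c * Y = - (e * X) \<and> c * Y' = - (e * X')"
      have "c * (X * Y' - Y * X') = X * (c * Y') - (c * Y) * X'" by (simp add: algebra_simps)
      then show ?thesis using h by simp
    qed
    then show ?thesis
      using \<open>c > 0\<close> unfolding X_def Y_def X'_def Y'_def rot_cross by simp
  qed
  have deg: "degree (A * B' - B * A') \<le> 2 * n"
    using AB AB' by (intro degree_diff_le degree_mult_le[THEN order_trans]) auto
  have "A * B' - B * A' = 0"
  proof (rule ccontr)
    assume nonzero: "A * B' - B * A' \<noteq> 0"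
    have "card (extremal_points \<omega> w) \<le> card {x. poly (A * B' - B * A') x = 0}"
      using root by (intro card_mono poly_roots_finite[OF nonzero]) auto
    also have "\<dots> \<le> 2 * n"
      using card_poly_roots_bound[OF nonzero] deg by simp
    finally show False using card by simp
  qed
  then show ?thesis
    using coprime_no_common_root[OF AB(2), of 0] coprime_no_common_root[OF AB'(2), of 0]
    unfolding AB(1) AB'(1) by (subst unitary_of_eq_iff) auto
qed

section \<open>Compactness and existence\<close>

text \<open>
  Bolzano-Weierstrass, one sequence after the other.
\<close>

lemma simultaneous_convergent_subsequence:
  fixes f :: "nat \<Rightarrow> nat \<Rightarrow> real"
  assumes bound: "\<And>i k. \<bar>f i k\<bar> \<le> C"
  shows "\<exists>r l. strict_mono (r :: nat \<Rightarrow> nat) \<and> (\<forall>i<N. (\<lambda>k. f i (r k)) \<longlonglongrightarrow> l i)"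
proof (induction N)
  case 0
  show ?case by (intro exI[of _ id]) (simp add: strict_mono_def)
next
  case (Suc N)
  then obtain r l where r: "strict_mono (r :: nat \<Rightarrow> nat)"
    and l: "\<And>i. i < N \<Longrightarrow> (\<lambda>k. f i (r k)) \<longlonglongrightarrow> l i" by blast
  have "f N (r k) \<in> {- C..C}" for k
    using bound[of N "r k"] by (simp add: abs_le_iff)
  then obtain y s where s: "strict_mono (s :: nat \<Rightarrow> nat)" and y: "((\<lambda>k. f N (r k)) \<circ> s) \<longlonglongrightarrow> y"
    using compact_Icc[of "- C" C] unfolding compact_def by meson
  have "(\<lambda>k. f i ((r \<circ> s) k)) \<longlonglongrightarrow> (l(N := y)) i" if "i < Suc N" for i
    using that y LIMSEQ_subseq_LIMSEQ[OF l s] by (cases "i = N") (auto simp: o_def)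
  then show ?case
    using strict_mono_o[OF r s] by blast
qed

lemma abs_poly_le_sum_coeff:
  fixes p :: "real poly"
  assumes "degree p \<le> n" "x \<in> {-1..1}"
  shows "\<bar>poly p x\<bar> \<le> (\<Sum>i\<le>n. \<bar>coeff p i\<bar>)"
proof -
  have "\<bar>poly p x\<bar> \<le> (\<Sum>i\<le>degree p. \<bar>coeff p i * x ^ i\<bar>)"
    unfolding poly_altdef by (rule sum_abs)
  also have "\<dots> \<le> (\<Sum>i\<le>degree p. \<bar>coeff p i\<bar>)"
    using assms(2) by (intro sum_mono) (auto simp: abs_mult power_abs intro!: mult_left_le power_le_one)
  also have "\<dots> \<le> (\<Sum>i\<le>n. \<bar>coeff p i\<bar>)"
    using assms(1) by (intro sum_mono2) auto
  finally show ?thesis .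
qed

lemma normalized_pair:
  assumes "u \<in> unitary_rat n"
  obtains A B where "u = unitary_of A B" "degree A \<le> n" "degree B \<le> n"
    "\<And>x. poly A x \<noteq> 0 \<or> poly B x \<noteq> 0"
    "(\<Sum>i\<le>n. \<bar>coeff A i\<bar> + \<bar>coeff B i\<bar>) = 1"
proof -
  obtain A B where AB: "u = unitary_of A B" "coprime A B" "degree A \<le> n" "degree B \<le> n"
    by (rule unitary_rat_coprime_pair[OF assms])
  have nz: "poly A x \<noteq> 0 \<or> poly B x \<noteq> 0" for x
    by (rule coprime_no_common_root[OF AB(2)])
  define M where "M = (\<Sum>i\<le>n. \<bar>coeff A i\<bar> + \<bar>coeff B i\<bar>)"
  have "M \<noteq> 0"
  proof
    assume "M = 0"
    then have "\<forall>i\<le>n. coeff A i = 0 \<and> coeff B i = 0"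
      unfolding M_def by (subst (asm) sum_nonneg_eq_0_iff) (auto simp: add_nonneg_eq_0_iff)
    then have "A = 0" "B = 0"
      using AB(3,4) by (meson leading_coeff_0_iff)+
    then show False using nz[of 0] by simp
  qed
  moreover have "0 \<le> M" unfolding M_def by (intro sum_nonneg) simp
  ultimately have M: "0 < M" by simp
  have "(\<Sum>i\<le>n. \<bar>coeff (smult (1 / M) A) i\<bar> + \<bar>coeff (smult (1 / M) B) i\<bar>) = M / M"
    using M by (simp add: abs_mult M_def[symmetric] flip: add_divide_distrib sum_divide_distrib)
  moreover have "u = unitary_of (smult (1 / M) A) (smult (1 / M) B)"
    unfolding AB(1) using nz[of 0] M by (subst unitary_of_eq_iff) (auto simp: mult.commute)
  ultimately show thesis
    using that[of "smult (1 / M) A" "smult (1 / M) B"] AB(3,4) nz M by simp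
qed

text \<open>
  The coefficients of normalized pairs are bounded, so they converge along a subsequence; the
  normalization prevents the limit pair from being zero. The limit may well have a common factor,
  in which case the rational functions need not converge uniformly.
\<close>

lemma unitary_rat_convergent_subsequence:
  assumes u: "\<And>k :: nat. u k \<in> unitary_rat n"
  obtains r A B \<A> \<B> \<eta> where "strict_mono (r :: nat \<Rightarrow> nat)"
    "A \<noteq> 0 \<or> B \<noteq> 0" "degree A \<le> n" "degree B \<le> n"
    "\<And>k. u (r k) = unitary_of (\<A> k) (\<B> k)"
    "\<And>k x. poly (\<A> k) x \<noteq> 0 \<or> poly (\<B> k) x \<noteq> 0"
    "\<eta> \<longlonglongrightarrow> (0::real)"
    "\<And>k x. x \<in> {-1..1} \<Longrightarrow> \<bar>poly (\<A> k) x - poly A x\<bar> \<le> \<eta> k"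
    "\<And>k x. x \<in> {-1..1} \<Longrightarrow> \<bar>poly (\<B> k) x - poly B x\<bar> \<le> \<eta> k"
proof -
  have "\<exists>A B. u k = unitary_of A B \<and> degree A \<le> n \<and> degree B \<le> n \<and>
      (\<forall>x. poly A x \<noteq> 0 \<or> poly B x \<noteq> 0) \<and> (\<Sum>i\<le>n. \<bar>coeff A i\<bar> + \<bar>coeff B i\<bar>) = 1" for k
    by (rule normalized_pair[OF u[of k]]) blast
  then obtain A0 B0 where AB0: "\<And>k. u k = unitary_of (A0 k) (B0 k)"
    "\<And>k. degree (A0 k) \<le> n" "\<And>k. degree (B0 k) \<le> n"
    "\<And>k x. poly (A0 k) x \<noteq> 0 \<or> poly (B0 k) x \<noteq> 0"
    "\<And>k. (\<Sum>i\<le>n. \<bar>coeff (A0 k) i\<bar> + \<bar>coeff (B0 k) i\<bar>) = 1"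
    by metis
  have coeff_le: "\<bar>coeff (A0 k) i\<bar> + \<bar>coeff (B0 k) i\<bar> \<le> 1" for k i
  proof (cases "i \<le> n")
    case True
    then show ?thesis
      using member_le_sum[of i "{..n}" "\<lambda>i. \<bar>coeff (A0 k) i\<bar> + \<bar>coeff (B0 k) i\<bar>"] AB0(5)[of k] by simp
  next
    case False
    then show ?thesis
      using AB0(2,3)[of k] by (simp add: coeff_eq_0)
  qed
  \<comment> \<open>The coefficients of both polynomials in one list of length \<open>2 (n + 1)\<close>.\<close>
  define f where "f i k = (if i \<le> n then coeff (A0 k) i else coeff (B0 k) (i - Suc n))" for i k
  have "\<bar>f i k\<bar> \<le> 1" for i k
    using coeff_le[of k i] coeff_le[of k "i - Suc n"] by (auto simp: f_def)
  then obtain r l where r: "strict_mono (r :: nat \<Rightarrow> nat)"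
    and l: "\<forall>i<2 * Suc n. (\<lambda>k. f i (r k)) \<longlonglongrightarrow> l i"
    using simultaneous_convergent_subsequence[of f 1 "2 * Suc n"] by blast
  define A B where "A = (\<Sum>i\<le>n. monom (l i) i)" and "B = (\<Sum>i\<le>n. monom (l (Suc n + i)) i)"
  have deg: "degree A \<le> n" "degree B \<le> n"
    unfolding A_def B_def by (auto intro!: degree_sum_le degree_monom_le[THEN order_trans])
  have cA: "(\<lambda>k. coeff (A0 (r k)) i) \<longlonglongrightarrow> coeff A i" if "i \<le> n" for i
    using l[rule_format, of i] that by (simp add: f_def A_def coeff_sum)
  have cB: "(\<lambda>k. coeff (B0 (r k)) i) \<longlonglongrightarrow> coeff B i" if "i \<le> n" for i
    using l[rule_format, of "Suc n + i"] that by (simp add: f_def B_def coeff_sum)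
  have "(\<lambda>k. \<Sum>i\<le>n. \<bar>coeff (A0 (r k)) i\<bar> + \<bar>coeff (B0 (r k)) i\<bar>) \<longlonglongrightarrow>
      (\<Sum>i\<le>n. \<bar>coeff A i\<bar> + \<bar>coeff B i\<bar>)"
    by (intro tendsto_intros cA cB) auto
  then have "(\<Sum>i\<le>n. \<bar>coeff A i\<bar> + \<bar>coeff B i\<bar>) = 1"
    unfolding AB0(5) by (simp add: LIMSEQ_const_iff)
  then have nz: "A \<noteq> 0 \<or> B \<noteq> 0" by auto
  define \<eta> where "\<eta> k = (\<Sum>i\<le>n. \<bar>coeff (A0 (r k)) i - coeff A i\<bar>) +
      (\<Sum>i\<le>n. \<bar>coeff (B0 (r k)) i - coeff B i\<bar>)" for k
  have "\<eta> \<longlonglongrightarrow> (\<Sum>i\<le>n. \<bar>coeff A i - coeff A i\<bar>) + (\<Sum>i\<le>n. \<bar>coeff B i - coeff B i\<bar>)"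
    unfolding \<eta>_def by (intro tendsto_intros cA cB) auto
  then have \<eta>: "\<eta> \<longlonglongrightarrow> 0" by simp
  have "\<bar>poly (A0 (r k)) x - poly A x\<bar> \<le> \<eta> k \<and> \<bar>poly (B0 (r k)) x - poly B x\<bar> \<le> \<eta> k"
    if "x \<in> {-1..1}" for k x
  proof -
    have "\<bar>poly (A0 (r k) - A) x\<bar> \<le> (\<Sum>i\<le>n. \<bar>coeff (A0 (r k) - A) i\<bar>)"
      "\<bar>poly (B0 (r k) - B) x\<bar> \<le> (\<Sum>i\<le>n. \<bar>coeff (B0 (r k) - B) i\<bar>)"
      using AB0(2,3) deg that by (intro abs_poly_le_sum_coeff degree_diff_le; simp)+
    moreover have "0 \<le> (\<Sum>i\<le>n. \<bar>coeff (A0 (r k)) i - coeff A i\<bar>)"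
      "0 \<le> (\<Sum>i\<le>n. \<bar>coeff (B0 (r k)) i - coeff B i\<bar>)"
      by (intro sum_nonneg; simp)+
    ultimately show ?thesis
      unfolding \<eta>_def poly_diff coeff_diff by linarith
  qed
  then show thesis
    using that[OF r nz deg, of "\<lambda>k. A0 (r k)" "\<lambda>k. B0 (r k)" \<eta>] AB0(1,4) \<eta> by simp
qed

text \<open>
  Lower semicontinuity of the error: the excess depends continuously on all data, which bounds the
  deviation at every point where the limit pair does not vanish. The finitely many remaining points
  are covered by continuity of the irreducible form.
\<close>

lemma approx_error_limit_le:
  assumes nz: "A \<noteq> 0 \<or> B \<noteq> 0" and deg: "degree A \<le> n" "degree B \<le> n"
    and nzk: "\<And>k x. poly (\<A> k) x \<noteq> 0 \<or> poly (\<B> k) x \<noteq> 0"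
    and mem: "\<And>k. unitary_of (\<A> k) (\<B> k) \<in> unitary_rat n"
    and \<eta>: "\<eta> \<longlonglongrightarrow> (0::real)"
    and bound: "\<And>k x. x \<in> {-1..1} \<Longrightarrow> \<bar>poly (\<A> k) x - poly A x\<bar> \<le> \<eta> k"
      "\<And>k x. x \<in> {-1..1} \<Longrightarrow> \<bar>poly (\<B> k) x - poly B x\<bar> \<le> \<eta> k"
    and \<omega>: "w \<longlonglongrightarrow> \<omega>" and d: "d \<longlonglongrightarrow> e"
    and le: "\<And>k. approx_error (w k) (unitary_of (\<A> k) (\<B> k)) \<le> d k"
  shows "approx_error \<omega> (unitary_of A B) \<le> e"
proof -
  define u where "u = unitary_of A B"
  have u: "u \<in> unitary_rat n"
    unfolding u_def by (rule unitary_of_in_unitary_rat[OF deg nz])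
  have d0: "0 \<le> d k" for k
    using approx_error_nonneg[OF mem[of k], of "w k"] le[of k] by simp
  have e: "0 \<le> e"
    using d d0 by (intro LIMSEQ_le_const[OF d]) auto
  have lim: "(\<lambda>k. poly (\<A> k) x) \<longlonglongrightarrow> poly A x" "(\<lambda>k. poly (\<B> k) x) \<longlonglongrightarrow> poly B x"
    if "x \<in> {-1..1}" for x
    by (rule LIM_zero_cancel, rule Lim_null_comparison[OF _ \<eta>], simp add: bound[OF that])+
  have generic: "deviation \<omega> u x \<le> e"
    if x: "x \<in> {-1..1}" and "poly A x \<noteq> 0 \<or> poly B x \<noteq> 0" for x
  proof -
    have "(\<lambda>k. excess (w k) (d k) (\<A> k) (\<B> k) x) \<longlonglongrightarrow> excess \<omega> e A B x"
      unfolding excess_def rot_Re_def rot_Im_def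
      by (intro tendsto_intros lim[OF x] \<omega> d) auto
    moreover have "excess (w k) (d k) (\<A> k) (\<B> k) x \<le> 0" for k
      using deviation_le_approx_error[OF mem x, of "w k" k] le[of k]
        deviation_le_iff[OF nzk[of k x] d0[of k], of "w k"] by simp
    ultimately have "excess \<omega> e A B x \<le> 0"
      by (intro LIMSEQ_le_const2) auto
    then show ?thesis
      unfolding u_def deviation_le_iff[OF that(2) e] .
  qed
  have "deviation \<omega> u x \<le> e" if x: "x \<in> {-1..1}" for x
  proof -
    define T where "T = {t. poly A t = 0} \<inter> {t. poly B t = 0}"
    have "finite T"
      using nz poly_roots_finite unfolding T_def by blast
    then have "\<forall>\<^sub>F t in at x. t \<notin> T"
      by (rule islimpt_finite[unfolded islimpt_iff_eventually not_not])
    then have "\<forall>\<^sub>F t in at x within {-1..1}. t \<notin> T"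
      by (rule filter_leD[OF at_le[OF subset_UNIV]])
    moreover have "\<forall>\<^sub>F t in at x within {-1..1}. t \<in> {-1..1}"
      by (simp add: eventually_at_filter)
    ultimately have "\<forall>\<^sub>F t in at x within {-1..1}. deviation \<omega> u t \<le> e"
      by eventually_elim (auto simp: T_def intro: generic)
    moreover have "(deviation \<omega> u \<longlongrightarrow> deviation \<omega> u x) (at x within {-1..1})"
      using continuous_on_deviation[OF u] x by (auto simp: continuous_on_def)
    moreover have "at x within {-1..1} \<noteq> bot"
      using x by (simp add: trivial_limit_within)
    ultimately show ?thesis
      by (intro tendsto_upperbound)
  qed
  then show ?thesis
    unfolding u_def[symmetric] by (simp add: approx_error_le_iff[OF u])
qed

text \<open>
  A minimizing sequence has a convergent subsequence of pairs, and semicontinuity applies to its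
  limit.
\<close>

lemma ex_minimizer: "\<exists>u\<in>unitary_rat n. \<forall>v\<in>unitary_rat n. approx_error \<omega> u \<le> approx_error \<omega> v"
proof -
  define e where "e = (INF u\<in>unitary_rat n. approx_error \<omega> u)"
  have bdd: "bdd_below (approx_error \<omega> ` unitary_rat n)"
    by (intro bdd_belowI2[where m = 0] approx_error_nonneg)
  have "unitary_of 1 0 \<in> unitary_rat n"
    by (intro unitary_of_in_unitary_rat) auto
  then have ne: "unitary_rat n \<noteq> {}" by blast
  have "\<exists>u\<in>unitary_rat n. approx_error \<omega> u < e + inverse (Suc k)" for k
    unfolding e_def by (subst cINF_less_iff[OF ne bdd, symmetric]) simp
  then obtain u where u: "\<And>k. u k \<in> unitary_rat n"
    and less: "\<And>k. approx_error \<omega> (u k) < e + inverse (Suc k)" by metis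
  obtain r A B \<A> \<B> \<eta> where r: "strict_mono (r :: nat \<Rightarrow> nat)"
    and AB: "A \<noteq> 0 \<or> B \<noteq> 0" "degree A \<le> n" "degree B \<le> n"
    and ur: "\<And>k. u (r k) = unitary_of (\<A> k) (\<B> k)"
    and nzk: "\<And>k x. poly (\<A> k) x \<noteq> 0 \<or> poly (\<B> k) x \<noteq> 0"
    and \<eta>: "\<eta> \<longlonglongrightarrow> (0::real)"
    and bound: "\<And>k x. x \<in> {-1..1} \<Longrightarrow> \<bar>poly (\<A> k) x - poly A x\<bar> \<le> \<eta> k"
      "\<And>k x. x \<in> {-1..1} \<Longrightarrow> \<bar>poly (\<B> k) x - poly B x\<bar> \<le> \<eta> k"
    by (rule unitary_rat_convergent_subsequence[of u n, OF u]) blast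
  have d: "(\<lambda>k. e + inverse (real (Suc (r k)))) \<longlonglongrightarrow> e + 0"
    using LIMSEQ_subseq_LIMSEQ[OF LIMSEQ_inverse_real_of_nat r]
    by (intro tendsto_intros) (simp add: o_def)
  have le: "approx_error \<omega> (unitary_of (\<A> k) (\<B> k)) \<le> e + inverse (real (Suc (r k)))" for k
    using less[of "r k"] unfolding ur by simp
  have mem: "unitary_of (\<A> k) (\<B> k) \<in> unitary_rat n" for k
    using u[of "r k"] unfolding ur .
  have "approx_error \<omega> (unitary_of A B) \<le> e + 0"
    by (rule approx_error_limit_le[OF AB nzk mem \<eta> bound tendsto_const d le])
  then have "approx_error \<omega> (unitary_of A B) \<le> e" by simp
  moreover have "e \<le> approx_error \<omega> v" if "v \<in> unitary_rat n" for v
    unfolding e_def using that by (intro cINF_lower bdd)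
  ultimately show ?thesis
    using unitary_of_in_unitary_rat[OF AB(2,3,1)] order_trans by blast
qed

section \<open>Continuity\<close>

text \<open>
  A common factor would leave a coprime pair of degree below \<open>n\<close>, against the degree count.
\<close>

lemma minimizer_pair_coprime:
  assumes AB: "A \<noteq> 0 \<or> B \<noteq> 0" "degree A \<le> n" "degree B \<le> n"
    and \<omega>: "\<omega> \<noteq> 0" and less: "approx_error \<omega> (unitary_of A B) < 2"
    and minimal: "\<And>v. v \<in> unitary_rat n \<Longrightarrow> approx_error \<omega> (unitary_of A B) \<le> approx_error \<omega> v"
  shows "coprime A B"
proof -
  obtain G A' B' where G: "A = G * A'" "B = G * B'" "G \<noteq> 0" "coprime A' B'"
    "unitary_of A B = unitary_of A' B'" "degree G + max (degree A') (degree B') \<le> n"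
    by (rule coprime_cofactors[OF AB])
  have "max (degree A') (degree B') = n"
    using extremal_points_of_minimizer(2)[OF G(4), of n \<omega>] G(5,6) \<omega> less minimal by simp
  then have "degree G = 0" using G(6) by simp
  then have "is_unit G" using G(3) by (simp add: is_unit_iff_degree)
  then show ?thesis
    using G(1,2,4) by (simp add: coprime_mult_left_iff coprime_mult_right_iff is_unit_left_imp_coprime
        is_unit_right_imp_coprime)
qed

text \<open>
  Since \<open>cnj Q / Q\<close> has modulus 1, only the modulus of \<open>P\<close> has to be bounded away from zero.
\<close>

lemma rat_eval_unitary_of_diff_le:
  assumes nz: "poly A x \<noteq> 0 \<or> poly B x \<noteq> 0" "poly A' x \<noteq> 0 \<or> poly B' x \<noteq> 0"
  shows "cmod (rat_eval (unitary_of A' B') (\<i> * of_real x) - rat_eval (unitary_of A B) (\<i> * of_real x)) \<le>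
    2 * (\<bar>poly A' x - poly A x\<bar> + \<bar>poly B' x - poly B x\<bar>) / sqrt ((poly A x)\<^sup>2 + (poly B x)\<^sup>2)"
proof -
  define P Q where "P = Complex (poly A x) (poly B x)" and "Q = Complex (poly A' x) (poly B' x)"
  have PQ: "P \<noteq> 0" "Q \<noteq> 0" using nz by (auto simp: P_def Q_def Complex_eq_0)
  have "rat_eval (unitary_of A' B') (\<i> * of_real x) - rat_eval (unitary_of A B) (\<i> * of_real x) =
      cnj Q / Q - cnj P / P"
    using nz by (simp add: rat_eval_unitary_of P_def Q_def complex_cnj)
  also have "\<dots> = (cnj Q * (P - Q) + Q * cnj (Q - P)) / (Q * P)"
    using PQ by (simp add: field_simps)
  also have "cmod \<dots> \<le> (cmod Q * cmod (Q - P) + cmod Q * cmod (Q - P)) / (cmod Q * cmod P)"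
    unfolding norm_divide norm_mult
    by (intro divide_right_mono order_trans[OF norm_triangle_ineq])
      (simp_all only: norm_mult complex_mod_cnj norm_minus_commute[of P Q] order_refl
        mult_nonneg_nonneg norm_ge_zero)
  also have "\<dots> = 2 * cmod (Q - P) / cmod P"
    using PQ by (simp add: field_simps)
  also have "cmod (Q - P) \<le> \<bar>poly A' x - poly A x\<bar> + \<bar>poly B' x - poly B x\<bar>"
    using cmod_le[of "Q - P"] by (simp add: P_def Q_def)
  finally have "cmod (rat_eval (unitary_of A' B') (\<i> * of_real x) - rat_eval (unitary_of A B) (\<i> * of_real x)) \<le>
      2 * (\<bar>poly A' x - poly A x\<bar> + \<bar>poly B' x - poly B x\<bar>) / cmod P"
    by (simp add: divide_right_mono)
  then show ?thesis
    by (simp add: P_def cmod_def)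
qed

lemma best_approx_minimal:
  shows best_approx_in_unitary_rat: "best_approx n \<omega> \<in> unitary_rat n"
    and best_approx_le: "v \<in> unitary_rat n \<Longrightarrow> approx_error \<omega> (best_approx n \<omega>) \<le> approx_error \<omega> v"
proof -
  obtain u where "is_arg_min (approx_error \<omega>) (\<lambda>u. u \<in> unitary_rat n) u"
    using ex_minimizer[of n \<omega>] by (auto simp: is_arg_min_linorder)
  then have "is_arg_min (approx_error \<omega>) (\<lambda>u. u \<in> unitary_rat n) (best_approx n \<omega>)"
    unfolding best_approx_def arg_min_def by (rule someI)
  then show "best_approx n \<omega> \<in> unitary_rat n"
    "v \<in> unitary_rat n \<Longrightarrow> approx_error \<omega> (best_approx n \<omega>) \<le> approx_error \<omega> v"
    by (auto simp: is_arg_min_linorder)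
qed

lemma best_approx_error_less_2:
  assumes "\<omega> \<in> {0<..<(real n + 1) * pi}"
  shows "approx_error \<omega> (best_approx n \<omega>) < 2"
proof -
  obtain v where "v \<in> unitary_rat n" "approx_error \<omega> v < 2"
    using ex_approx_error_less_2[of \<omega> n] assms by auto
  then show ?thesis
    using best_approx_le[of v n \<omega>] by linarith
qed

lemma best_approx_eqI:
  assumes "\<omega> \<in> {0<..<(real n + 1) * pi}" "u \<in> unitary_rat n"
    and "approx_error \<omega> u \<le> approx_error \<omega> (best_approx n \<omega>)"
  shows "u = best_approx n \<omega>"
proof (rule minimizer_unique[OF assms(2) best_approx_in_unitary_rat])
  show "approx_error \<omega> u \<le> approx_error \<omega> w" if "w \<in> unitary_rat n" for w
    using assms(3) best_approx_le[OF that] by (rule order_trans)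
  show "approx_error \<omega> u < 2"
    using assms(3) best_approx_error_less_2[OF assms(1)] by (rule order.strict_trans1)
  show "\<omega> \<noteq> 0" using assms(1) by simp
qed (rule best_approx_le)

text \<open>
  Otherwise some frequencies converging to \<open>a\<close> have best approximations that stay away from the one
  at \<open>a\<close>. A subsequence of their pairs converges, and by uniqueness the limit represents the best
  approximation at \<open>a\<close>. As a minimizing pair it is coprime, so its modulus on the segment is bounded
  below and the rational functions converge uniformly, a contradiction.
\<close>

lemma continuous_on_best_approx:
  "continuous_on {0<..<(real n + 1) * pi} (\<lambda>\<omega>. segment_fun (best_approx n \<omega>))"
proof (rule ccontr)
  let ?\<Omega> = "{0<..<(real n + 1) * pi}"
  assume "\<not> continuous_on ?\<Omega> (\<lambda>\<omega>. segment_fun (best_approx n \<omega>))"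
  then obtain a \<epsilon> where a: "a \<in> ?\<Omega>" and \<epsilon>: "\<epsilon> > 0"
    and far: "\<And>\<delta>. \<delta> > 0 \<Longrightarrow> \<exists>\<omega>\<in>?\<Omega>. dist \<omega> a < \<delta> \<and>
      \<not> dist (segment_fun (best_approx n \<omega>)) (segment_fun (best_approx n a)) < \<epsilon>"
    unfolding continuous_on_iff by blast
  have "\<exists>\<omega>\<in>?\<Omega>. dist \<omega> a < inverse (Suc k) \<and>
      \<not> dist (segment_fun (best_approx n \<omega>)) (segment_fun (best_approx n a)) < \<epsilon>" for k
    by (rule far) simp
  then obtain w where w: "\<And>k. w k \<in> ?\<Omega>" "\<And>k. dist (w k) a < inverse (Suc k)"
    "\<And>k. \<not> dist (segment_fun (best_approx n (w k))) (segment_fun (best_approx n a)) < \<epsilon>"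
    by metis
  have wa: "w \<longlonglongrightarrow> a"
  proof (rule iffD2[OF tendsto_dist_iff], rule tendsto_sandwich[OF _ _ tendsto_const])
    show "(\<lambda>k. inverse (real (Suc k))) \<longlonglongrightarrow> 0"
      by (rule LIMSEQ_inverse_real_of_nat)
  qed (use w(2) in \<open>auto intro: always_eventually less_imp_le\<close>)
  obtain r A B \<A> \<B> \<eta> where r: "strict_mono (r :: nat \<Rightarrow> nat)"
    and AB: "A \<noteq> 0 \<or> B \<noteq> 0" "degree A \<le> n" "degree B \<le> n"
    and ur: "\<And>k. best_approx n (w (r k)) = unitary_of (\<A> k) (\<B> k)"
    and nzk: "\<And>k x. poly (\<A> k) x \<noteq> 0 \<or> poly (\<B> k) x \<noteq> 0"
    and \<eta>: "\<eta> \<longlonglongrightarrow> (0::real)"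
    and bound: "\<And>k x. x \<in> {-1..1} \<Longrightarrow> \<bar>poly (\<A> k) x - poly A x\<bar> \<le> \<eta> k"
      "\<And>k x. x \<in> {-1..1} \<Longrightarrow> \<bar>poly (\<B> k) x - poly B x\<bar> \<le> \<eta> k"
    by (rule unitary_rat_convergent_subsequence[of "\<lambda>k. best_approx n (w k)" n,
          OF best_approx_in_unitary_rat]) blast
  have wr: "(\<lambda>k. w (r k)) \<longlonglongrightarrow> a"
    using LIMSEQ_subseq_LIMSEQ[OF wa r] by (simp add: o_def)
  have d: "(\<lambda>k. approx_error a (best_approx n a) + \<bar>w (r k) - a\<bar>) \<longlonglongrightarrow>
      approx_error a (best_approx n a) + \<bar>a - a\<bar>"
    by (rule tendsto_add[OF tendsto_const tendsto_rabs[OF tendsto_diff[OF wr tendsto_const]]])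
  have le: "approx_error (w (r k)) (unitary_of (\<A> k) (\<B> k)) \<le>
      approx_error a (best_approx n a) + \<bar>w (r k) - a\<bar>" for k
    using best_approx_le[OF best_approx_in_unitary_rat[of n a], of "w (r k)"]
      approx_error_Lipschitz[OF best_approx_in_unitary_rat, of "w (r k)" n a a]
    unfolding ur by linarith
  have mem: "unitary_of (\<A> k) (\<B> k) \<in> unitary_rat n" for k
    using best_approx_in_unitary_rat[of n "w (r k)"] unfolding ur .
  have "approx_error a (unitary_of A B) \<le> approx_error a (best_approx n a) + \<bar>a - a\<bar>"
    by (rule approx_error_limit_le[OF AB nzk mem \<eta> bound wr d le])
  then have ua: "unitary_of A B = best_approx n a"
    by (intro best_approx_eqI[OF a] unitary_of_in_unitary_rat AB) simp
  have "coprime A B"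
    using minimizer_pair_coprime[OF AB, of a] best_approx_error_less_2[OF a] best_approx_le[of _ n a] a
    unfolding ua by simp
  then have nz: "poly A x \<noteq> 0 \<or> poly B x \<noteq> 0" for x
    by (rule coprime_no_common_root)
  have cont: "continuous_on {-1..1::real} (\<lambda>x. sqrt ((poly A x)\<^sup>2 + (poly B x)\<^sup>2))"
    by (intro continuous_intros)
  have "{-1..1::real} \<noteq> {}" by simp
  from continuous_attains_inf[OF compact_Icc this cont]
  obtain x0 where x0: "\<And>x. x \<in> {-1..1} \<Longrightarrow>
      sqrt ((poly A x0)\<^sup>2 + (poly B x0)\<^sup>2) \<le> sqrt ((poly A x)\<^sup>2 + (poly B x)\<^sup>2)"
    by blast
  define c where "c = sqrt ((poly A x0)\<^sup>2 + (poly B x0)\<^sup>2)"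
  have c: "0 < c"
    using nz[of x0] by (simp add: c_def sum_power2_gt_zero_iff)
  have "\<epsilon> \<le> 4 * \<eta> k / c" for k
  proof -
    have "cmod (rat_eval (unitary_of (\<A> k) (\<B> k)) (\<i> * of_real x) -
        rat_eval (unitary_of A B) (\<i> * of_real x)) \<le> 4 * \<eta> k / c" if x: "x \<in> {-1..1}" for x
    proof -
      have "2 * (\<bar>poly (\<A> k) x - poly A x\<bar> + \<bar>poly (\<B> k) x - poly B x\<bar>) /
          sqrt ((poly A x)\<^sup>2 + (poly B x)\<^sup>2) \<le> 4 * \<eta> k / c"
        using bound[OF x, of k] x0[OF x] c by (intro frac_le) (auto simp: c_def)
      then show ?thesis
        using rat_eval_unitary_of_diff_le[OF nz nzk[of k x]] by (rule order_trans[rotated])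
    qed
    then have "dist (segment_fun (best_approx n (w (r k)))) (segment_fun (best_approx n a)) \<le> 4 * \<eta> k / c"
      unfolding dist_segment_fun[OF best_approx_in_unitary_rat best_approx_in_unitary_rat]
      unfolding imag_norm_def ur ua[symmetric] by (intro cSUP_least) auto
    then show ?thesis using w(3)[of "r k"] by simp
  qed
  moreover have "(\<lambda>k. 4 * \<eta> k / c) \<longlonglongrightarrow> 4 * 0 / c"
    using c by (intro tendsto_intros \<eta>) auto
  ultimately have "\<epsilon> \<le> 4 * 0 / c"
    by (intro LIMSEQ_le_const) auto
  then show False using \<epsilon> by simp
qed

theorem proposition7p1:
  fixes n :: nat
  assumes "n \<ge> 1"
  shows "(\<forall>\<omega>\<in>{0<..<(real n + 1) * pi}.
            \<exists>!u. is_arg_min (approx_error \<omega>) (\<lambda>u. u \<in> unitary_rat n) u) \<and>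
         continuous_on {0<..<(real n + 1) * pi} (\<lambda>\<omega>. segment_fun (best_approx n \<omega>)) \<and>
         (\<forall>\<omega>\<^sub>a\<in>{0<..<(real n + 1) * pi}.
            ((\<lambda>\<omega>. imag_norm (\<lambda>z. rat_eval (best_approx n \<omega>) z - rat_eval (best_approx n \<omega>\<^sub>a) z))
              \<longlongrightarrow> 0) (at \<omega>\<^sub>a))"
proof (intro conjI ballI)
  fix \<omega> :: real assume \<omega>: "\<omega> \<in> {0<..<(real n + 1) * pi}"
  show "\<exists>!u. is_arg_min (approx_error \<omega>) (\<lambda>u. u \<in> unitary_rat n) u"
  proof (rule ex1I[of _ "best_approx n \<omega>"])
    show "is_arg_min (approx_error \<omega>) (\<lambda>u. u \<in> unitary_rat n) (best_approx n \<omega>)"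
      by (simp add: is_arg_min_linorder best_approx_minimal)
    show "u = best_approx n \<omega>" if "is_arg_min (approx_error \<omega>) (\<lambda>u. u \<in> unitary_rat n) u" for u
      using that by (intro best_approx_eqI[OF \<omega>])
        (auto simp: is_arg_min_linorder best_approx_in_unitary_rat)
  qed
next
  show "continuous_on {0<..<(real n + 1) * pi} (\<lambda>\<omega>. segment_fun (best_approx n \<omega>))"
    by (rule continuous_on_best_approx)
next
  fix \<omega>\<^sub>a :: real assume a: "\<omega>\<^sub>a \<in> {0<..<(real n + 1) * pi}"
  then have "((\<lambda>\<omega>. segment_fun (best_approx n \<omega>)) \<longlongrightarrow> segment_fun (best_approx n \<omega>\<^sub>a)) (at \<omega>\<^sub>a)"
    using continuous_on_best_approx[of n]
    unfolding continuous_on_eq_continuous_at[OF open_greaterThanLessThan] isCont_def by blast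
  then show "((\<lambda>\<omega>. imag_norm (\<lambda>z. rat_eval (best_approx n \<omega>) z - rat_eval (best_approx n \<omega>\<^sub>a) z))
      \<longlongrightarrow> 0) (at \<omega>\<^sub>a)"
    unfolding tendsto_dist_iff[of _ "segment_fun (best_approx n \<omega>\<^sub>a)"]
    by (simp only: dist_segment_fun[OF best_approx_in_unitary_rat best_approx_in_unitary_rat])
qed

end
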